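(* Let $n\ge 2$, $0<m<1/2$, and $$E_{2m} = \{ z \in \mathbb{C}^n : |z_1|^{2m} + |z_2|^2 + \cdots + |z_n|^2 < 1 \}.$$ Let $0<p<1$, write $(p,\hat 0)=(p,0,\ldots,0)\in E_{2m}$, and let $v=(v_1,\ldots,v_n)\in\mathbb{C}^n$, $v\neq 0$, be a tangent vector at $(p,\hat 0)$. Put $$w=\frac{p^2(|v_2|^2+\cdots+|v_n|^2)}{m^2|v_1|^2}$$ (with $w=+\infty$ if $v_1=0$). When $w\le \frac{1}{4m(1-m)}$, put $$t=\frac{2m^2w}{1+2m(m-1)w+\big(1+4m(m-1)w\big)^{1/2}},$$ let $\alpha$ be the unique positive solution in the interval $(0,1)$ of the equation $\alpha^{2m}-t\alpha^{2m-2}-(1-t)p^{2m}=0$, and put $$K_1\big((p,\hat0),v\big)=\frac{m\alpha(1-t)|v_1|}{p(1-\alpha^2)\,(m(1-t)+t)}.$$ Put also $$K_2\big((p,\hat0),v\big)=\left(\frac{m^2p^{2m-2}|v_1|^2}{(1-p^{2m})^2}+\frac{|v_2|^2}{1-p^{2m}}+\cdots+\frac{|v_n|^2}{1-p^{2m}}\right)^{1/2}.$$ Then the Kobayashi metric of $E_{2m}$ at $(p,\hat0)$ is given by $$K_{E_{2m}}\big((p,\hat0),v\big)=\begin{cases}K_1\big((p,\hat0),v\big) & \text{if } w\le 1,\\ K_2\big((p,\hat0),v\big) & \text{if } w\ge\frac{1}{4m(1-m)},\\ \min\{K_1\big((p,\hat0),v\big),K_2\big((p,\hat0),v\big)\}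 & \text{if } 1<w<\frac{1}{4m(1-m)}.\end{cases}$$ Moreover, there is a $w_0$ (depending on $p$ and $m$) with $1<w_0<\frac{1}{4m(1-m)}$ such that $K_{E_{2m}}\big((p,\hat0),v\big)=K_1\big((p,\hat0),v\big)$ for $w\le w_0$ and $K_{E_{2m}}\big((p,\hat0),v\big)=K_2\big((p,\hat0),v\big)$ for $w\ge w_0$. Furthermore, $$w_0=\frac{t_0}{(m+(1-m)t_0)^2},\qquad t_0=\frac{x_0^{2m}-p^{2m}}{x_0^{2m-2}-p^{2m}},$$ where $x_0$ is the solution in $(0,1)$ of the equation $$-(1-m)^2x^{4m}+\big(-1-2m+2m^2+p^{2m}\big)x^{4m-2}-m^2x^{4m-4}+\big(1-(2m-1)p^{2m}\big)x^{2m}+\big(1+(2m-1)p^{2m}\big)x^{2m-2}-p^{2m}=0.$$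
   Context: Kobayashi metric: let $\mathbb{D}$ be the open unit disc in $\mathbb{C}$. For a domain $D\subset\mathbb{C}^n$, $z\in D$, $v\in\mathbb{C}^n$, $$K_D(z,v)=\inf\{ |\lambda| : \lambda \in\mathbb{C},\ \text{there is a holomorphic } f:\mathbb{D}\to D \text{ with } f(0)=z,\ \lambda f'(0)=v\}.$$ *)

theory Defs
  imports "HOL-Complex_Analysis.Complex_Analysis"
begin

text \<open>
  A map from the unit disc to \<open>\<complex>\<^sup>n\<close> is holomorphic iff its components are. The type \<open>'n\<close> indexes
  the coordinates, and in everything below \<open>k :: 'n\<close> is the distinguished one, that of \<open>z\<^sub>1\<close>.
\<close>

definition holomorphic_disc :: "(complex \<Rightarrow> complex ^ 'n) \<Rightarrow> (complex ^ 'n) set \<Rightarrow> bool" where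
  "holomorphic_disc f D \<longleftrightarrow>
     (\<forall>i. (\<lambda>\<zeta>. f \<zeta> $ i) holomorphic_on ball 0 1) \<and> f ` ball 0 1 \<subseteq> D"

definition disc_deriv :: "(complex \<Rightarrow> complex ^ 'n) \<Rightarrow> complex \<Rightarrow> complex ^ 'n" where
  "disc_deriv f \<zeta> = (\<chi> i. deriv (\<lambda>\<xi>. f \<xi> $ i) \<zeta>)"

definition kobayashi_competitors ::
    "(complex ^ 'n) set \<Rightarrow> complex ^ 'n \<Rightarrow> complex ^ 'n \<Rightarrow> complex set" where
  "kobayashi_competitors D z v =
     {l. \<exists>f. holomorphic_disc f D \<and> f 0 = z \<and> l *s disc_deriv f 0 = v}"

definition kobayashi :: "(complex ^ 'n) set \<Rightarrow> complex ^ 'n \<Rightarrow> complex ^ 'n \<Rightarrow> real" where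
  "kobayashi D z v = Inf (cmod ` kobayashi_competitors D z v)"

text \<open>The real infimum is only meaningful for a nonempty set; this holds at points of open sets.\<close>

lemma kobayashi_competitors_nonempty:
  fixes D :: "(complex ^ 'n) set"
  assumes "open D" "z \<in> D"
  shows "kobayashi_competitors D z v \<noteq> {}"
proof -
  obtain e where e: "e > 0" "ball z e \<subseteq> D"
    using assms open_contains_ball by blast
  define c :: real where "c = e / (norm v + 1)"
  have c: "c > 0" using e by (simp add: c_def add_nonneg_pos)
  define f where "f = (\<lambda>\<zeta>. z + (\<zeta> * of_real c) *s v)"
  have norm_scale: "norm (a *s v) = cmod a * norm v" for a
    by (simp add: norm_vec_def L2_set_def norm_mult power_mult_distrib
        sum_distrib_left[symmetric] real_sqrt_mult)
  have "f \<zeta> \<in> ball z e" if "\<zeta> \<in> ball 0 1" for \<zeta>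
  proof -
    have "dist z (f \<zeta>) = cmod \<zeta> * c * norm v"
      using c by (simp add: f_def dist_norm norm_scale norm_mult)
    also have "\<dots> \<le> c * norm v"
      using that c by (intro mult_right_mono) (auto simp: mult_le_cancel_right1)
    also have "\<dots> < e"
      using e by (simp add: c_def field_simps add_pos_nonneg add_nonneg_pos)
    finally show ?thesis by simp
  qed
  then have "holomorphic_disc f D"
    using e by (auto simp: holomorphic_disc_def f_def intro!: holomorphic_intros)
  moreover have "f 0 = z"
    by (simp add: f_def)
  moreover have "disc_deriv f 0 = of_real c *s v"
  proof -
    have "((\<lambda>\<zeta>. f \<zeta> $ i) has_field_derivative of_real c * v $ i) (at 0)" for i
      unfolding f_def by (auto intro!: derivative_eq_intros)
    then show ?thesis
      by (simp add: disc_deriv_def vec_eq_iff DERIV_imp_deriv)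
  qed
  then have "(1 / of_real c) *s disc_deriv f 0 = v"
    using c by (simp add: vec_eq_iff)
  ultimately show ?thesis
    by (auto simp: kobayashi_competitors_def)
qed

definition ellipsoid :: "'n::finite \<Rightarrow> real \<Rightarrow> (complex ^ 'n) set" where
  "ellipsoid k m = {z. cmod (z $ k) powr (2 * m) + (\<Sum>i\<in>UNIV - {k}. (cmod (z $ i))\<^sup>2) < 1}"

definition w_par :: "'n::finite \<Rightarrow> real \<Rightarrow> real \<Rightarrow> complex ^ 'n \<Rightarrow> ereal" where
  "w_par k m p v =
     (if v $ k = 0 then \<infinity>
      else ereal (p\<^sup>2 * (\<Sum>i\<in>UNIV - {k}. (cmod (v $ i))\<^sup>2) / (m\<^sup>2 * (cmod (v $ k))\<^sup>2)))"

definition w_max :: "real \<Rightarrow> real" where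
  "w_max m = 1 / (4 * m * (1 - m))"

text \<open>\<open>t_par\<close>, \<open>alpha_par\<close> and \<open>K1\<close> are meaningful only when \<open>w_par k m p v \<le> w_max m\<close>.\<close>

definition t_par :: "real \<Rightarrow> real \<Rightarrow> real" where
  "t_par m w = 2 * m\<^sup>2 * w / (1 + 2 * m * (m - 1) * w + sqrt (1 + 4 * m * (m - 1) * w))"

definition alpha_sol :: "real \<Rightarrow> real \<Rightarrow> real \<Rightarrow> real \<Rightarrow> bool" where
  "alpha_sol m p t a \<longleftrightarrow> 0 < a \<and> a < 1 \<and>
     a powr (2 * m) - t * a powr (2 * m - 2) - (1 - t) * p powr (2 * m) = 0"

definition alpha_par :: "real \<Rightarrow> real \<Rightarrow> real \<Rightarrow> real" where
  "alpha_par m p t = (THE a. alpha_sol m p t a)"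

definition K1 :: "'n::finite \<Rightarrow> real \<Rightarrow> real \<Rightarrow> complex ^ 'n \<Rightarrow> real" where
  "K1 k m p v =
     (let t = t_par m (real_of_ereal (w_par k m p v)); a = alpha_par m p t
      in m * a * (1 - t) * cmod (v $ k) / (p * (1 - a\<^sup>2) * (m * (1 - t) + t)))"

definition K2 :: "'n::finite \<Rightarrow> real \<Rightarrow> real \<Rightarrow> complex ^ 'n \<Rightarrow> real" where
  "K2 k m p v =
     sqrt (m\<^sup>2 * p powr (2 * m - 2) * (cmod (v $ k))\<^sup>2 / (1 - p powr (2 * m))\<^sup>2
           + (\<Sum>i\<in>UNIV - {k}. (cmod (v $ i))\<^sup>2 / (1 - p powr (2 * m))))"

definition x0_sol :: "real \<Rightarrow> real \<Rightarrow> real \<Rightarrow> bool" where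
  "x0_sol m p x \<longleftrightarrow> 0 < x \<and> x < 1 \<and>
     - (1 - m)\<^sup>2 * x powr (4 * m)
     + (- 1 - 2 * m + 2 * m\<^sup>2 + p powr (2 * m)) * x powr (4 * m - 2)
     - m\<^sup>2 * x powr (4 * m - 4)
     + (1 - (2 * m - 1) * p powr (2 * m)) * x powr (2 * m)
     + (1 + (2 * m - 1) * p powr (2 * m)) * x powr (2 * m - 2)
     - p powr (2 * m) = 0"

end

theory Submission
  imports Defs
begin

text \<open>
  Let \<open>f = (f\<^sub>1, g)\<close> be a disc in the ellipsoid centred at \<open>(p, 0)\<close>, and write \<open>f\<^sub>1 = B h\<close> with a
  Blaschke product \<open>B\<close> and \<open>h\<close> without zeros. On the circle \<open>|h| = |f\<^sub>1|\<close>, so by the maximum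
  principle \<open>(h\<^sup>m, g)\<close> is a disc in the ball. The Schwarz lemmas for \<open>B\<close> and for the ball bound
  \<open>f'(0)\<close> in terms of \<open>a = |B(0)| \<in> [p, 1]\<close> only. What is left is to maximize over \<open>a\<close>. The interior
  critical points form an envelope, parametrized by the solution \<open>\<alpha>\<close> of the theorem, and yield
  \<open>K\<^sub>1\<close>, while the end point \<open>a = 1\<close>, where \<open>f\<^sub>1\<close> has no zeros, yields \<open>K\<^sub>2\<close>. When the bound for the
  ball would be attained by a map with \<open>h\<^sup>m\<close> vanishing somewhere, it has to be replaced by a stronger
  one for maps into the convex domain \<open>{(\<phi>, g). exp (2 Re \<phi>) + |g|\<^sup>2 < 1}\<close>.

  The envelope crosses the sphere of the ball metric exactly once, because the ball norm along it
  decreases up to the cusp and then increases to \<open>1\<close>. The crossing is the point \<open>x\<^sub>0\<close>.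
\<close>

section \<open>Schwarz lemmas\<close>

lemma cmod_cauchy_schwarz2:
  fixes a b c d :: complex
  shows "(cmod (a * c + b * d))\<^sup>2 \<le> ((cmod a)\<^sup>2 + (cmod b)\<^sup>2) * ((cmod c)\<^sup>2 + (cmod d)\<^sup>2)"
proof -
  have "(cmod (a * c + b * d))\<^sup>2 \<le> (cmod a * cmod c + cmod b * cmod d)\<^sup>2"
    using norm_triangle_ineq[of "a * c" "b * d"] by (intro power_mono) (auto simp: norm_mult)
  also have "\<dots> \<le> ((cmod a)\<^sup>2 + (cmod b)\<^sup>2) * ((cmod c)\<^sup>2 + (cmod d)\<^sup>2)"
    using zero_le_power2[of "cmod a * cmod d - cmod b * cmod c"]
    by (simp add: power2_eq_square algebra_simps)
  finally show ?thesis .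
qed

lemma cmod2_moebius:
  "(cmod (1 - cnj w * k))\<^sup>2 - (cmod (k - w))\<^sup>2 = (1 - (cmod w)\<^sup>2) * (1 - (cmod k)\<^sup>2)"
  by (simp only: cmod_power2) (simp add: power2_eq_square algebra_simps)

lemma moebius_denominator_nonzero:
  fixes w z :: complex
  assumes "cmod w < 1" "cmod z \<le> 1"
  shows "1 - cnj w * z \<noteq> 0"
proof
  assume "1 - cnj w * z = 0"
  then have "cmod (cnj w * z) = 1" by (metis eq_iff_diff_eq_0 norm_one)
  moreover have "cmod (cnj w * z) \<le> cmod w" using assms
    by (simp add: norm_mult mult_left_le)
  ultimately show False using assms by simp
qed

lemma ball_schwarz_strict:
  fixes k g :: "complex \<Rightarrow> complex"
  assumes hol: "k holomorphic_on ball 0 1" "g holomorphic_on ball 0 1"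
    and le: "\<And>z. z \<in> ball 0 1 \<Longrightarrow> (cmod (k z))\<^sup>2 + (cmod (g z))\<^sup>2 < 1"
    and g0: "g 0 = 0"
  shows "(cmod (deriv k 0))\<^sup>2 + (1 - (cmod (k 0))\<^sup>2) * (cmod (deriv g 0))\<^sup>2 \<le> (1 - (cmod (k 0))\<^sup>2)\<^sup>2"
proof -
  define w where "w = k 0"
  define u where "u = 1 - (cmod w)\<^sup>2"
  have u: "u > 0" using le[of 0] g0 by (simp add: u_def w_def)
  have k1: "cmod (k z) < 1" if "z \<in> ball 0 1" for z
  proof -
    have "(cmod (k z))\<^sup>2 < 1" using le[OF that] zero_le_power2[of "cmod (g z)"] by linarith
    then show ?thesis using abs_square_less_1[of "cmod (k z)"] by simp
  qed
  have w1: "cmod w < 1" using k1[of 0] by (simp add: w_def)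
  have nz: "1 - cnj w * k z \<noteq> 0" if "z \<in> ball 0 1" for z
    using moebius_denominator_nonzero[OF w1, of "k z"] k1[OF that] by simp
  define F1 where "F1 = (\<lambda>z. (k z - w) / (1 - cnj w * k z))"
  define F2 where "F2 = (\<lambda>z. of_real (sqrt u) * g z / (1 - cnj w * k z))"
  have F_lt: "(cmod (F1 z))\<^sup>2 + (cmod (F2 z))\<^sup>2 < 1" if z: "z \<in> ball 0 1" for z
  proof -
    have "(cmod (k z - w))\<^sup>2 + u * (cmod (g z))\<^sup>2 < (cmod (k z - w))\<^sup>2 + u * (1 - (cmod (k z))\<^sup>2)"
      using le[OF z] u by simp
    also have "\<dots> = (cmod (1 - cnj w * k z))\<^sup>2"
      using cmod2_moebius[of w "k z"] by (simp add: u_def)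
    finally show ?thesis using nz[OF z] u
      by (simp add: F1_def F2_def norm_divide norm_mult power_divide power_mult_distrib
          add_divide_distrib[symmetric] divide_simps)
  qed
  have dk: "(k has_field_derivative deriv k 0) (at 0)" and dg: "(g has_field_derivative deriv g 0) (at 0)"
    using hol by (auto intro!: holomorphic_derivI[of _ "ball 0 1"])
  have uc: "1 - cnj w * w = of_real u"
    by (simp add: u_def complex_norm_square mult.commute del: of_real_power)
  have D1: "(F1 has_field_derivative deriv k 0 / u) (at 0)"
    unfolding F1_def using nz[of 0] u
    by (auto intro!: derivative_eq_intros dk simp: w_def[symmetric] uc)
  have D2: "(F2 has_field_derivative sqrt u * deriv g 0 / u) (at 0)"
    unfolding F2_def using nz[of 0] u
    by (auto intro!: derivative_eq_intros dg dk simp: w_def[symmetric] uc g0)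
  define A where "A = deriv k 0 / u"
  define C where "C = sqrt u * deriv g 0 / u"
  define M where "M = (cmod A)\<^sup>2 + (cmod C)\<^sup>2"
  have "M \<le> 1"
  proof (rule ccontr)
    assume "\<not> M \<le> 1"
    then have M: "M > 1" by simp
    define S where "S = (\<lambda>z. (cnj A * F1 z + cnj C * F2 z) / of_real (sqrt M))"
    have "S holomorphic_on ball 0 1"
      unfolding S_def F1_def F2_def using nz hol M by (intro holomorphic_intros) auto
    moreover have "S 0 = 0" by (simp add: S_def F1_def F2_def w_def g0)
    moreover have "cmod (S z) < 1" if "cmod z < 1" for z
    proof -
      have "(cmod (cnj A * F1 z + cnj C * F2 z))\<^sup>2 \<le> M * ((cmod (F1 z))\<^sup>2 + (cmod (F2 z))\<^sup>2)"
        using cmod_cauchy_schwarz2[of "cnj A" "F1 z" "cnj C" "F2 z"] by (simp add: M_def)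
      also have "\<dots> < M * 1" using F_lt[of z] that M by (intro mult_strict_left_mono) auto
      finally have "(cmod (S z))\<^sup>2 < 1" using M
        by (simp add: S_def norm_divide power_divide)
      then show ?thesis by (simp add: power_less_one_iff abs_square_less_1)
    qed
    ultimately have "cmod (deriv S 0) \<le> 1" using Schwarz_Lemma(2)[of S 0] by simp
    moreover have "(S has_field_derivative (cnj A * A + cnj C * C) / of_real (sqrt M)) (at 0)"
      unfolding S_def A_def C_def by (intro DERIV_cdivide DERIV_add DERIV_cmult D1 D2)
    then have "deriv S 0 = of_real (M / sqrt M)"
      by (simp add: DERIV_imp_deriv M_def complex_norm_square mult.commute del: of_real_power)
    ultimately have "cmod (of_real (M / sqrt M)) \<le> 1" by simp
    then have "M / sqrt M \<le> 1" using M by (simp only: norm_of_real)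
    then show False using M by (simp add: real_div_sqrt)
  qed
  moreover have "M = ((cmod (deriv k 0))\<^sup>2 + u * (cmod (deriv g 0))\<^sup>2) / u\<^sup>2"
    using u by (simp add: M_def A_def C_def norm_divide norm_mult power_divide power_mult_distrib
      add_divide_distrib)
  ultimately show ?thesis using u by (simp add: u_def w_def)
qed

lemma ball_schwarz:
  fixes k g :: "complex \<Rightarrow> complex"
  assumes hol: "k holomorphic_on ball 0 1" "g holomorphic_on ball 0 1"
    and le: "\<And>z. z \<in> ball 0 1 \<Longrightarrow> (cmod (k z))\<^sup>2 + (cmod (g z))\<^sup>2 \<le> 1"
    and g0: "g 0 = 0"
  shows "(cmod (deriv k 0))\<^sup>2 + (1 - (cmod (k 0))\<^sup>2) * (cmod (deriv g 0))\<^sup>2 \<le> (1 - (cmod (k 0))\<^sup>2)\<^sup>2"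
    and "(cmod (deriv g 0))\<^sup>2 \<le> 1 - (cmod (k 0))\<^sup>2"
proof -
  define q where "q = (cmod (k 0))\<^sup>2"
  have q: "0 \<le> q" "q \<le> 1" using le[of 0] g0 by (auto simp: q_def)
  have *: "t\<^sup>2 * (cmod (deriv k 0))\<^sup>2 + (1 - t\<^sup>2 * q) * (t\<^sup>2 * (cmod (deriv g 0))\<^sup>2) \<le> (1 - t\<^sup>2 * q)\<^sup>2"
    if t: "0 < t" "t < 1" for t :: real
  proof -
    have "(cmod (of_real t * k z))\<^sup>2 + (cmod (of_real t * g z))\<^sup>2 < 1" if "z \<in> ball 0 1" for z
    proof -
      have "(cmod (of_real t * k z))\<^sup>2 + (cmod (of_real t * g z))\<^sup>2
          = t\<^sup>2 * ((cmod (k z))\<^sup>2 + (cmod (g z))\<^sup>2)"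
        by (simp add: norm_mult power_mult_distrib algebra_simps)
      also have "\<dots> \<le> t\<^sup>2 * 1" using le[OF that] by (intro mult_left_mono) auto
      also have "\<dots> < 1" using t by (simp add: power_less_one_iff)
      finally show ?thesis .
    qed
    from ball_schwarz_strict[of "\<lambda>z. of_real t * k z" "\<lambda>z. of_real t * g z", OF _ _ this]
    have "(cmod (deriv (\<lambda>z. of_real t * k z) 0))\<^sup>2
        + (1 - (cmod (of_real t * k 0))\<^sup>2) * (cmod (deriv (\<lambda>z. of_real t * g z) 0))\<^sup>2
        \<le> (1 - (cmod (of_real t * k 0))\<^sup>2)\<^sup>2"
      using hol g0 by (simp add: holomorphic_intros)
    moreover have "deriv (\<lambda>z. of_real t * k z) 0 = of_real t * deriv k 0"
      "deriv (\<lambda>z. of_real t * g z) 0 = of_real t * deriv g 0"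
      using hol by (auto intro!: deriv_cmult simp: holomorphic_on_imp_differentiable_at[of _ "ball 0 1"])
    ultimately show ?thesis by (simp add: norm_mult power_mult_distrib q_def)
  qed
  have ev: "eventually (\<lambda>t::real. 0 < t \<and> t < 1) (at_left 1)"
    using eventually_at_left_real[of 0 "1::real"] by (auto elim: eventually_mono)
  have "(cmod (deriv k 0))\<^sup>2 + (1 - q) * (cmod (deriv g 0))\<^sup>2 \<le> (1 - q)\<^sup>2"
  proof (rule tendsto_le[OF trivial_limit_at_left_real])
    show "((\<lambda>t. (1 - t\<^sup>2 * q)\<^sup>2) \<longlongrightarrow> (1 - q)\<^sup>2) (at_left (1::real))"
      by (auto intro!: tendsto_eq_intros)
    show "((\<lambda>t. t\<^sup>2 * (cmod (deriv k 0))\<^sup>2 + (1 - t\<^sup>2 * q) * (t\<^sup>2 * (cmod (deriv g 0))\<^sup>2))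
      \<longlongrightarrow> (cmod (deriv k 0))\<^sup>2 + (1 - q) * (cmod (deriv g 0))\<^sup>2) (at_left 1)"
      by (auto intro!: tendsto_eq_intros)
    show "\<forall>\<^sub>F t in at_left 1. t\<^sup>2 * (cmod (deriv k 0))\<^sup>2 + (1 - t\<^sup>2 * q) * (t\<^sup>2 * (cmod (deriv g 0))\<^sup>2)
      \<le> (1 - t\<^sup>2 * q)\<^sup>2"
      using ev by eventually_elim (use * in blast)
  qed
  then show "(cmod (deriv k 0))\<^sup>2 + (1 - (cmod (k 0))\<^sup>2) * (cmod (deriv g 0))\<^sup>2 \<le> (1 - (cmod (k 0))\<^sup>2)\<^sup>2"
    by (simp add: q_def)
  have **: "t\<^sup>2 * (cmod (deriv g 0))\<^sup>2 \<le> 1 - t\<^sup>2 * q" if t: "0 < t" "t < 1" for t :: real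
  proof -
    have "t\<^sup>2 < 1" using t by (simp add: power_less_one_iff)
    then have u: "1 - t\<^sup>2 * q > 0" using q mult_left_le[of q "t\<^sup>2"] by simp
    have "(1 - t\<^sup>2 * q) * (t\<^sup>2 * (cmod (deriv g 0))\<^sup>2) \<le> (1 - t\<^sup>2 * q) * (1 - t\<^sup>2 * q)"
      using *[OF t] zero_le_power2[of "t * cmod (deriv k 0)"]
      unfolding power_mult_distrib power2_eq_square[of "1 - t\<^sup>2 * q"] by linarith
    then show ?thesis using u by simp
  qed
  have "(cmod (deriv g 0))\<^sup>2 \<le> 1 - q"
  proof (rule tendsto_le[OF trivial_limit_at_left_real])
    show "((\<lambda>t. 1 - t\<^sup>2 * q) \<longlongrightarrow> 1 - q) (at_left (1::real))"
      by (auto intro!: tendsto_eq_intros)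
    show "((\<lambda>t. t\<^sup>2 * (cmod (deriv g 0))\<^sup>2) \<longlongrightarrow> (cmod (deriv g 0))\<^sup>2) (at_left 1)"
      by (auto intro!: tendsto_eq_intros)
    show "\<forall>\<^sub>F t in at_left 1. t\<^sup>2 * (cmod (deriv g 0))\<^sup>2 \<le> 1 - t\<^sup>2 * q"
      using ev by eventually_elim (use ** in blast)
  qed
  then show "(cmod (deriv g 0))\<^sup>2 \<le> 1 - (cmod (k 0))\<^sup>2" by (simp add: q_def)
qed

lemma schwarz_pick_0:
  assumes "f holomorphic_on ball 0 1" "\<And>z. z \<in> ball 0 1 \<Longrightarrow> cmod (f z) \<le> 1"
  shows "cmod (deriv f 0) \<le> 1 - (cmod (f 0))\<^sup>2"
proof -
  have "(cmod (f 0))\<^sup>2 \<le> 1" using assms(2)[of 0] by (simp add: power_le_one_iff)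
  moreover have "(cmod (deriv f 0))\<^sup>2 \<le> (1 - (cmod (f 0))\<^sup>2)\<^sup>2"
    using ball_schwarz(1)[of f "\<lambda>_. 0"] assms by (simp add: power_le_one_iff)
  ultimately show ?thesis by (simp add: power2_le_iff_abs_le abs_le_square_iff[symmetric])
qed

lemma cmod2_geodesic_identity:
  fixes q c :: real and z :: complex
  shows "(cmod (1 - of_real (c * q) * z))\<^sup>2 - q * (cmod (1 - of_real c * z))\<^sup>2
     - (1 - q) * (1 - c\<^sup>2 * q) * (cmod z)\<^sup>2 = (1 - q) * (1 - (cmod z)\<^sup>2)"
  by (simp only: cmod_power2) (simp add: power2_eq_square algebra_simps)

lemma one_minus_unit_mult:
  fixes z :: complex
  assumes "\<bar>c\<bar> \<le> 1" "cmod z < 1"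
  shows "Re (1 - of_real c * z) > 0"
proof -
  have "\<bar>c\<bar> * \<bar>Re z\<bar> \<le> \<bar>Re z\<bar>" using assms mult_right_mono[of "\<bar>c\<bar>" 1 "\<bar>Re z\<bar>"] by simp
  then have "\<bar>c * Re z\<bar> < 1" using assms abs_Re_le_cmod[of z] by (simp add: abs_mult)
  then show ?thesis by simp
qed

lemma pair_maximum_principle:
  fixes k g :: "complex \<Rightarrow> complex"
  assumes hol: "k holomorphic_on ball 0 1" "g holomorphic_on ball 0 1"
    and cont: "continuous_on (cball 0 1) \<Psi>"
    and \<Psi>: "\<And>z. z \<in> ball 0 1 \<Longrightarrow> \<Psi> z = (cmod (k z))\<^sup>2 + (cmod (g z))\<^sup>2"
    and bd: "\<And>z. z \<in> sphere 0 1 \<Longrightarrow> \<Psi> z \<le> (1::real)"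
    and z: "z \<in> ball 0 1"
  shows "(cmod (k z))\<^sup>2 + (cmod (g z))\<^sup>2 \<le> 1"
proof (rule ccontr)
  assume "\<not> ?thesis"
  then have z1: "\<Psi> z > 1" using \<Psi>[OF z] by simp
  obtain x where x: "x \<in> cball 0 1" and xmax: "\<And>y. y \<in> cball 0 1 \<Longrightarrow> \<Psi> y \<le> \<Psi> x"
    using continuous_attains_sup[OF compact_cball _ cont] by (auto simp: cball_eq_empty)
  define M where "M = \<Psi> x"
  have M: "M > 1" using xmax[of z] z z1 by (simp add: M_def)
  have xb: "x \<in> ball 0 1" using bd[of x] M x by (force simp: M_def)
  define S where "S = (\<lambda>y. cnj (k x) * k y + cnj (g x) * g y)"
  have S_le: "(cmod (S y))\<^sup>2 \<le> M * \<Psi> y" if "y \<in> ball 0 1" for y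
    using cmod_cauchy_schwarz2[of "cnj (k x)" "k y" "cnj (g x)" "g y"] that
    by (simp add: S_def M_def \<Psi>[OF xb] \<Psi>[OF that])
  have "S x = of_real M"
    using xb by (simp add: S_def M_def \<Psi> complex_norm_square mult.commute del: of_real_power)
  then have Sx: "cmod (S x) = M" using M by simp
  have "S constant_on ball 0 1"
  proof (rule maximum_modulus_principle[of S "ball 0 1" "ball 0 1" x])
    show "S holomorphic_on ball 0 1" unfolding S_def using hol by (intro holomorphic_intros)
    show "cmod (S y) \<le> cmod (S x)" if "y \<in> ball 0 1" for y
    proof -
      have "(cmod (S y))\<^sup>2 \<le> M\<^sup>2"
        unfolding power2_eq_square[of M]
        by (rule order_trans[OF S_le[OF that]], rule mult_left_mono)
          (use xmax[of y] that M in \<open>auto simp: M_def\<close>)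
      then show ?thesis using Sx M by (simp add: power2_le_iff_abs_le)
    qed
  qed (use xb in auto)
  then have "cmod (S y) = M" if "y \<in> ball 0 1" for y
    using Sx xb that by (metis constant_on_def)
  then have ge: "M \<le> \<Psi> y" if "y \<in> ball 0 1" for y
    using S_le[OF that] M that by (simp add: power2_eq_square)
  have "M \<le> \<Psi> 1"
  proof (rule continuous_ge_on_closure[of "ball 0 1" \<Psi>])
    show "continuous_on (closure (ball 0 1)) \<Psi>" using cont by simp
    show "(1::complex) \<in> closure (ball 0 1)" by simp
  qed (use ge in auto)
  then show False using bd[of 1] M by simp
qed

lemma blaschke_factorization:
  fixes f :: "complex \<Rightarrow> complex"
  assumes "finite {z \<in> ball 0 1. f z = 0}"
    and "f holomorphic_on ball 0 1" "continuous_on (cball 0 1) f" "f 0 \<noteq> 0"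
  obtains B h where "B holomorphic_on ball 0 1" "h holomorphic_on ball 0 1"
    "continuous_on (cball 0 1) h" "\<And>z. z \<in> ball 0 1 \<Longrightarrow> f z = B z * h z"
    "\<And>z. z \<in> ball 0 1 \<Longrightarrow> cmod (B z) \<le> 1" "\<And>z. z \<in> ball 0 1 \<Longrightarrow> h z \<noteq> 0"
    "\<And>z. z \<in> sphere 0 1 \<Longrightarrow> cmod (h z) = cmod (f z)"
proof -
  have "\<exists>B h. B holomorphic_on ball 0 1 \<and> h holomorphic_on ball 0 1 \<and>
      continuous_on (cball 0 1) h \<and> (\<forall>z \<in> ball 0 1. f z = B z * h z) \<and>
      (\<forall>z \<in> ball 0 1. cmod (B z) \<le> 1) \<and> (\<forall>z \<in> ball 0 1. h z \<noteq> 0) \<and>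
      (\<forall>z \<in> sphere 0 1. cmod (h z) = cmod (f z))"
    using assms
  proof (induction "{z \<in> ball 0 1. f z = 0}" arbitrary: f rule: finite_psubset_induct)
    case psubset
    note f = psubset.prems
    show ?case
    proof (cases "{z \<in> ball 0 1. f z = 0} = {}")
      case True
      then show ?thesis using f
        by (intro exI[of _ "\<lambda>_. 1"] exI[of _ f]) auto
    next
      case False
      then obtain b where b: "b \<in> ball 0 1" "f b = 0" by blast
      then have b1: "cmod b < 1" by simp
      have "\<not> f constant_on ball 0 1"
        using b f(3) by (metis constant_on_def centre_in_ball zero_less_one)
      then obtain g r n where n: "0 < n" and r: "0 < r" "ball b r \<subseteq> ball 0 1"
        and g: "g holomorphic_on ball b r"
        and fg: "\<And>w. w \<in> ball b r \<Longrightarrow> f w = (w - b) ^ n * g w"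
        and gnz: "\<And>w. w \<in> ball b r \<Longrightarrow> g w \<noteq> 0"
        using holomorphic_factor_zero_nonconstant[OF f(1) open_ball _ b] by (metis connected_ball)
      define h where "h = (\<lambda>z. if z = b then g b * (1 - cnj b * z) ^ n
          else f z * ((1 - cnj b * z) / (z - b)) ^ n)"
      have nz: "1 - cnj b * z \<noteq> 0" if "z \<in> cball 0 1" for z
        using moebius_denominator_nonzero[OF b1] that by simp
      have hb: "h z = g z * (1 - cnj b * z) ^ n" if "z \<in> ball b r" for z
        using fg[OF that] by (auto simp: h_def power_divide)
      have "h holomorphic_on ball b r \<union> (ball 0 1 - {b})"
      proof (rule holomorphic_on_Un)
        have "(\<lambda>z. g z * (1 - cnj b * z) ^ n) holomorphic_on ball b r"
          using g by (intro holomorphic_intros)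
        then show "h holomorphic_on ball b r" by (rule holomorphic_transform) (simp add: hb)
        have "(\<lambda>z. f z * ((1 - cnj b * z) / (z - b)) ^ n) holomorphic_on ball 0 1 - {b}"
          using f(1) by (intro holomorphic_intros) (auto intro: holomorphic_on_subset)
        then show "h holomorphic_on ball 0 1 - {b}"
          by (rule holomorphic_transform) (simp add: h_def)
      qed (auto intro: open_delete)
      moreover have "ball b r \<union> (ball 0 1 - {b}) = ball 0 1" using r b by auto
      ultimately have holh: "h holomorphic_on ball 0 1" by simp
      have conth: "continuous_on (cball 0 1) h"
      proof -
        have "continuous_on (ball 0 1 \<union> (cball 0 1 - {b})) h"
        proof (rule continuous_on_Un_local_open)
          have eq: "ball 0 1 \<union> (cball 0 1 - {b}) = cball 0 1" using b by auto
          show "openin (top_of_set (ball 0 1 \<union> (cball 0 1 - {b}))) (ball 0 1)"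
            unfolding eq by (rule open_subset) auto
          show "openin (top_of_set (ball 0 1 \<union> (cball 0 1 - {b}))) (cball 0 1 - {b})"
            unfolding eq by (simp add: openin_delete)
          show "continuous_on (ball 0 1) h" by (rule holomorphic_on_imp_continuous_on[OF holh])
          have "continuous_on (cball 0 1 - {b}) (\<lambda>z. f z * ((1 - cnj b * z) / (z - b)) ^ n)"
            using f(2) by (intro continuous_intros) (auto intro: continuous_on_subset)
          then show "continuous_on (cball 0 1 - {b}) h"
            by (rule continuous_on_eq) (simp add: h_def)
        qed
        moreover have "ball 0 1 \<union> (cball 0 1 - {b}) = cball 0 1" using b by auto
        ultimately show ?thesis by simp
      qed
      have h0: "h z = 0 \<longleftrightarrow> f z = 0 \<and> z \<noteq> b" if "z \<in> cball 0 1" for z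
        using nz[OF that] gnz[of b] r by (auto simp: h_def)
      have "{z \<in> ball 0 1. h z = 0} \<subset> {z \<in> ball 0 1. f z = 0}"
      proof
        show "{z \<in> ball 0 1. h z = 0} \<subseteq> {z \<in> ball 0 1. f z = 0}" using h0 by auto
        have "b \<in> {z \<in> ball 0 1. f z = 0}" "b \<notin> {z \<in> ball 0 1. h z = 0}" using b h0[of b] by auto
        then show "{z \<in> ball 0 1. h z = 0} \<noteq> {z \<in> ball 0 1. f z = 0}" by blast
      qed
      moreover have "h 0 \<noteq> 0" using h0[of 0] f(3) by simp
      ultimately obtain B1 h1 where 1: "B1 holomorphic_on ball 0 1" "h1 holomorphic_on ball 0 1"
        "continuous_on (cball 0 1) h1" "\<forall>z \<in> ball 0 1. h z = B1 z * h1 z"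
        "\<forall>z \<in> ball 0 1. cmod (B1 z) \<le> 1" "\<forall>z \<in> ball 0 1. h1 z \<noteq> 0"
        "\<forall>z \<in> sphere 0 1. cmod (h1 z) = cmod (h z)"
        using psubset.hyps(2)[of h] holh conth by blast
      define C where "C = (\<lambda>z. ((z - b) / (1 - cnj b * z)) ^ n)"
      have fC: "f z = C z * h z" if "z \<in> cball 0 1" for z
        using nz[OF that] b by (auto simp: C_def h_def power_divide n)
      have C_id: "(cmod (1 - cnj b * z))\<^sup>2 - (cmod (z - b))\<^sup>2 = (1 - (cmod b)\<^sup>2) * (1 - (cmod z)\<^sup>2)" for z
        by (rule cmod2_moebius)
      have C1: "cmod (C z) \<le> 1" if "z \<in> ball 0 1" for z
      proof -
        have "(cmod b)\<^sup>2 < 1" "(cmod z)\<^sup>2 < 1" using that b1 by (auto simp: abs_square_less_1)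
        then have "(cmod (z - b))\<^sup>2 \<le> (cmod (1 - cnj b * z))\<^sup>2"
          using C_id[of z] mult_nonneg_nonneg[of "1 - (cmod b)\<^sup>2" "1 - (cmod z)\<^sup>2"] by linarith
        then have "cmod (z - b) \<le> cmod (1 - cnj b * z)" by (rule power2_le_imp_le) simp
        then show ?thesis using nz[of z] that
          by (simp add: C_def norm_power norm_divide power_le_one divide_le_eq_1)
      qed
      have C2: "cmod (C z) = 1" if "z \<in> sphere 0 1" for z
      proof -
        have "(cmod (z - b))\<^sup>2 = (cmod (1 - cnj b * z))\<^sup>2" using C_id[of z] that by simp
        then have "cmod (z - b) = cmod (1 - cnj b * z)" by simp
        then show ?thesis using nz[of z] that by (simp add: C_def norm_power norm_divide)
      qed
      have "(\<lambda>z. C z * B1 z) holomorphic_on ball 0 1"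
        unfolding C_def using 1(1) nz by (intro holomorphic_intros) auto
      moreover have "cmod (C z * B1 z) \<le> 1" if "z \<in> ball 0 1" for z
        using C1[OF that] 1(5) that by (simp add: norm_mult mult_le_one)
      moreover have "cmod (h1 z) = cmod (f z)" if "z \<in> sphere 0 1" for z
        using 1(7) C2[OF that] fC[of z] that by (simp add: norm_mult)
      moreover have "f z = C z * B1 z * h1 z" if "z \<in> ball 0 1" for z
        using fC[of z] 1(4) that by simp
      ultimately show ?thesis using 1
        by (intro exI[of _ "\<lambda>z. C z * B1 z"] exI[of _ h1]) auto
    qed
  qed
  then show thesis using that by blast
qed

text \<open>
  For \<open>G \<le> 1 - q\<close> this improves on the estimate of \<open>ball_schwarz\<close> for \<open>k = exp \<phi>\<close>, since it uses
  that \<open>k\<close> has no zeros. The pairs \<open>(\<phi>, g)\<close> satisfying the hypothesis form a convex set.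
\<close>

lemma log_schwarz:
  fixes \<phi> g :: "complex \<Rightarrow> complex"
  assumes hol: "\<phi> holomorphic_on ball 0 1" "g holomorphic_on ball 0 1"
    and le: "\<And>z. z \<in> ball 0 1 \<Longrightarrow> exp (2 * Re (\<phi> z)) + (cmod (g z))\<^sup>2 \<le> 1"
    and g0: "g 0 = 0"
    and q: "q = exp (2 * Re (\<phi> 0))" and G: "G = cmod (deriv g 0)" "0 < G" "G \<le> 1 - q"
  shows "cmod (deriv \<phi> 0) \<le> G + ln ((1 - G) / q)"
proof -
  define W where "W = cmod (deriv \<phi> 0)"
  define \<eta> where "\<eta> = (if W = 0 then 1 else - deriv \<phi> 0 / W)"
  have \<eta>: "cmod \<eta> = 1" "deriv \<phi> 0 = - \<eta> * W"
    by (auto simp: \<eta>_def W_def norm_divide)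
  define p where "p = 1 - G"
  have q0: "q > 0" by (simp add: q)
  have p: "0 < p" "p < 1" "q \<le> p" using G(2,3) q0 unfolding p_def by linarith+
  define \<omega> where "\<omega> = deriv g 0 / G"
  have \<omega>: "cmod \<omega> = 1" "deriv g 0 = \<omega> * G"
    using G by (auto simp: \<omega>_def norm_divide)
  \<comment> \<open>The geodesic of the ball whose first component vanishes at a boundary point. It is the critical
    one: the estimate is tangent to the ball estimate there, and convexity gives it for all other discs.\<close>
  define \<phi>0 where "\<phi>0 = (\<lambda>z. of_real (ln p / 2) + Ln (1 - \<eta> * z) - Ln (1 - of_real p * (\<eta> * z)))"
  define g1 where "g1 = (\<lambda>z. \<omega> * G * z / (1 - of_real p * (\<eta> * z)))"
  have re1: "Re (1 - \<eta> * z) > 0" "Re (1 - of_real p * (\<eta> * z)) > 0" if "z \<in> ball 0 1" for z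
    using one_minus_unit_mult[of 1 "\<eta> * z"] one_minus_unit_mult[of p "\<eta> * z"] that p \<eta>
    by (auto simp: norm_mult)
  have nr: "1 - \<eta> * z \<notin> \<real>\<^sub>\<le>\<^sub>0" "1 - of_real p * (\<eta> * z) \<notin> \<real>\<^sub>\<le>\<^sub>0" if "z \<in> ball 0 1" for z
    using re1[OF that] by (auto simp: complex_nonpos_Reals_iff)
  have nz: "1 - \<eta> * z \<noteq> 0" "1 - of_real p * (\<eta> * z) \<noteq> 0" if "z \<in> ball 0 1" for z
    using re1[OF that] by fastforce+
  have hol0: "\<phi>0 holomorphic_on ball 0 1" "g1 holomorphic_on ball 0 1"
    unfolding \<phi>0_def g1_def using nr nz by (auto intro!: holomorphic_intros)
  have exp0: "exp (2 * Re (\<phi>0 z)) = p * (cmod (1 - \<eta> * z))\<^sup>2 / (cmod (1 - of_real p * (\<eta> * z)))\<^sup>2"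
    if "z \<in> ball 0 1" for z
  proof -
    have "exp (2 * Re (\<phi>0 z)) = exp (ln p + (2 * ln (cmod (1 - \<eta> * z)) - 2 * ln (cmod (1 - of_real p * (\<eta> * z)))))"
      using nz[OF that] by (simp add: \<phi>0_def Re_Ln algebra_simps)
    also have "\<dots> = p * (exp (2 * ln (cmod (1 - \<eta> * z))) / exp (2 * ln (cmod (1 - of_real p * (\<eta> * z)))))"
      using p by (simp add: exp_add exp_diff)
    also have "exp (2 * ln x) = x\<^sup>2" if "x > 0" for x :: real
      using that by (simp add: exp_double)
    then show ?thesis using nz[OF that] calculation by simp
  qed
  have le0: "exp (2 * Re (\<phi>0 z)) + (cmod (g1 z))\<^sup>2 \<le> 1" if z: "z \<in> ball 0 1" for z
  proof -
    have "(cmod (1 - of_real p * (\<eta> * z)))\<^sup>2 - p * (cmod (1 - \<eta> * z))\<^sup>2 - G * G * (cmod z)\<^sup>2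
        = (1 - p) * (1 - (cmod z)\<^sup>2)"
      using cmod2_geodesic_identity[of 1 p "\<eta> * z"] \<eta>(1)
      by (simp add: norm_mult p_def)
    moreover have "(1 - p) * (1 - (cmod z)\<^sup>2) \<ge> 0"
      using p z abs_square_less_1[of "cmod z"] by simp
    ultimately have "p * (cmod (1 - \<eta> * z))\<^sup>2 + G * G * (cmod z)\<^sup>2 \<le> (cmod (1 - of_real p * (\<eta> * z)))\<^sup>2"
      by simp
    moreover have "(cmod (g1 z))\<^sup>2 = G * G * (cmod z)\<^sup>2 / (cmod (1 - of_real p * (\<eta> * z)))\<^sup>2"
      using G \<omega> by (simp add: g1_def norm_mult norm_divide power_mult_distrib power_divide power2_eq_square)
    ultimately show ?thesis using nz[OF z]
      by (simp add: exp0[OF z] add_divide_distrib[symmetric] divide_le_eq_1)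
  qed
  have der0: "deriv \<phi>0 0 = - \<eta> * G" "deriv g1 0 = \<omega> * G"
    unfolding \<phi>0_def g1_def
    by (auto intro!: DERIV_imp_deriv derivative_eq_intros simp: p_def algebra_simps)
  define Q where "Q = (\<lambda>e. exp ((1 - e) * ln p + e * ln q))"
  define T where "T = (\<lambda>e. (1 - Q e)\<^sup>2 - (1 - Q e) * G\<^sup>2 - Q e * ((1 - e) * G + e * W)\<^sup>2)"
  have T_nonneg: "T e \<ge> 0" if e: "0 \<le> e" "e \<le> 1" for e
  proof -
    define \<psi> where "\<psi> = (\<lambda>z. of_real (1 - e) * \<phi>0 z + of_real e * \<phi> z)"
    define k where "k = (\<lambda>z. exp (\<psi> z))"
    define h where "h = (\<lambda>z. of_real (1 - e) * g1 z + of_real e * g z)"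
    have hol1: "\<psi> holomorphic_on ball 0 1" "h holomorphic_on ball 0 1"
      unfolding \<psi>_def h_def by (intro holomorphic_intros hol hol0)+
    have holk: "k holomorphic_on ball 0 1" unfolding k_def by (intro holomorphic_intros hol1)
    have "(cmod (k z))\<^sup>2 + (cmod (h z))\<^sup>2 \<le> 1" if z: "z \<in> ball 0 1" for z
    proof -
      have "(cmod (k z))\<^sup>2 = exp ((1 - e) * (2 * Re (\<phi>0 z)) + e * (2 * Re (\<phi> z)))"
        by (simp add: k_def \<psi>_def exp_double[symmetric] algebra_simps)
      also have "\<dots> \<le> (1 - e) * exp (2 * Re (\<phi>0 z)) + e * exp (2 * Re (\<phi> z))"
        using convex_onD[OF exp_convex, of e "2 * Re (\<phi>0 z)" "2 * Re (\<phi> z)"] e by simp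
      finally have 1: "(cmod (k z))\<^sup>2 \<le> (1 - e) * exp (2 * Re (\<phi>0 z)) + e * exp (2 * Re (\<phi> z))" .
      have "cmod (h z) \<le> (1 - e) * cmod (g1 z) + e * cmod (g z)"
        unfolding h_def using e by (intro norm_triangle_le) (simp add: norm_mult del: of_real_diff)
      then have "(cmod (h z))\<^sup>2 \<le> ((1 - e) * cmod (g1 z) + e * cmod (g z))\<^sup>2" by (intro power_mono) auto
      also have "\<dots> \<le> (1 - e) * (cmod (g1 z))\<^sup>2 + e * (cmod (g z))\<^sup>2"
        using convex_onD[OF convex_power2, of e "cmod (g1 z)" "cmod (g z)"] e by simp
      finally have "(cmod (k z))\<^sup>2 + (cmod (h z))\<^sup>2 \<le> (1 - e) * (exp (2 * Re (\<phi>0 z)) + (cmod (g1 z))\<^sup>2)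
          + e * (exp (2 * Re (\<phi> z)) + (cmod (g z))\<^sup>2)"
        using 1 by (simp add: algebra_simps)
      also have "\<dots> \<le> (1 - e) * 1 + e * 1"
        using e le[OF z] le0[OF z] by (intro add_mono mult_left_mono) auto
      finally show ?thesis by simp
    qed
    moreover have "h 0 = 0" by (simp add: h_def g1_def g0)
    ultimately have bs: "(cmod (deriv k 0))\<^sup>2 + (1 - (cmod (k 0))\<^sup>2) * (cmod (deriv h 0))\<^sup>2
        \<le> (1 - (cmod (k 0))\<^sup>2)\<^sup>2"
      by (intro ball_schwarz(1) holk hol1)
    have dh: "deriv h 0 = \<omega> * G"
    proof -
      have "(h has_field_derivative of_real (1 - e) * deriv g1 0 + of_real e * deriv g 0) (at 0)"
        unfolding h_def using hol hol0
        by (intro DERIV_add DERIV_cmult holomorphic_derivI[of _ "ball 0 1"]) auto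
      then show ?thesis using der0 \<omega> by (simp add: DERIV_imp_deriv algebra_simps)
    qed
    have "(\<psi> has_field_derivative of_real (1 - e) * deriv \<phi>0 0 + of_real e * deriv \<phi> 0) (at 0)"
      unfolding \<psi>_def using hol hol0
      by (intro DERIV_add DERIV_cmult holomorphic_derivI[of _ "ball 0 1"]) auto
    then have d\<psi>: "(\<psi> has_field_derivative - \<eta> * of_real ((1 - e) * G + e * W)) (at 0)"
      using der0 \<eta> by (simp add: algebra_simps)
    have "deriv k 0 = exp (\<psi> 0) * (- \<eta> * of_real ((1 - e) * G + e * W))"
      unfolding k_def by (intro DERIV_imp_deriv DERIV_chain2[OF DERIV_exp] d\<psi>)
    then have dk: "(cmod (deriv k 0))\<^sup>2 = (cmod (k 0))\<^sup>2 * ((1 - e) * G + e * W)\<^sup>2"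
      using \<eta> by (simp add: norm_mult power_mult_distrib k_def del: of_real_add of_real_mult)
    have "(cmod (k 0))\<^sup>2 = exp (2 * Re (\<psi> 0))" by (simp add: k_def exp_double[symmetric])
    also have "2 * Re (\<psi> 0) = (1 - e) * ln p + e * ln q"
      by (simp add: \<psi>_def \<phi>0_def q field_simps)
    finally have k0: "(cmod (k 0))\<^sup>2 = Q e" by (simp add: Q_def)
    show ?thesis using bs by (simp add: T_def dk k0 dh norm_mult \<omega> G(1)[symmetric])
  qed
  have Q0: "Q 0 = p" using p by (simp add: Q_def)
  have "(Q has_real_derivative p * (ln q - ln p)) (at 0)"
    unfolding Q_def using p by (auto intro!: derivative_eq_intros)
  then have dT: "(T has_real_derivative - 2 * G * p * (ln q - ln p + W - G)) (at 0)"
    unfolding T_def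
    by (auto intro!: derivative_eq_intros simp: Q0) (simp add: p_def power2_eq_square algebra_simps)
  have T0: "T 0 = 0" by (simp add: T_def Q0 p_def power2_eq_square algebra_simps)
  have "\<not> - 2 * G * p * (ln q - ln p + W - G) < 0"
  proof
    assume "- 2 * G * p * (ln q - ln p + W - G) < 0"
    then obtain d where d: "d > 0" "\<And>h. h > 0 \<Longrightarrow> h < d \<Longrightarrow> T (0 + h) < T 0"
      using DERIV_neg_dec_right[OF dT] by auto
    have "T (min (d/2) 1) < 0" using d(2)[of "min (d/2) 1"] d(1) T0 by auto
    then show False using T_nonneg[of "min (d/2) 1"] d(1) by auto
  qed
  then have "2 * G * p * (ln q - ln p + W - G) \<le> 0" by simp
  then have "ln q - ln p + W - G \<le> 0" using G p by (simp add: mult_le_0_iff)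
  then show ?thesis using p q0 by (simp add: W_def ln_div p_def)
qed

text \<open>Here \<open>a\<close> is the modulus at \<open>0\<close> of the Blaschke product of \<open>f\<close>.\<close>

lemma disc_pair_estimate:
  fixes f g :: "complex \<Rightarrow> complex"
  assumes hol: "f holomorphic_on ball 0 R" "g holomorphic_on ball 0 R" and R: "R > 1"
    and le: "\<And>z. z \<in> ball 0 R \<Longrightarrow> cmod (f z) powr (2 * m) + (cmod (g z))\<^sup>2 \<le> 1"
    and f0: "f 0 = of_real p" and g0: "g 0 = 0" and p: "0 < p" and m: "0 < m"
    and G: "G = cmod (deriv g 0)"
  obtains a W where "p \<le> a" "a \<le> 1" "0 \<le> W"
    "cmod (deriv f 0) \<le> p * ((1 - a\<^sup>2) / a + W / m)"
    "(p / a) powr (2 * m) * W\<^sup>2 + (1 - (p / a) powr (2 * m)) * G\<^sup>2 \<le> (1 - (p / a) powr (2 * m))\<^sup>2"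
    "G\<^sup>2 \<le> 1 - (p / a) powr (2 * m)"
    "0 < G \<Longrightarrow> G \<le> 1 - (p / a) powr (2 * m) \<Longrightarrow> W \<le> G + ln ((1 - G) / (p / a) powr (2 * m))"
proof -
  have sub: "ball 0 1 \<subseteq> ball (0::complex) R" "cball 0 1 \<subseteq> ball (0::complex) R" using R by auto
  have hol1: "f holomorphic_on ball 0 1" "g holomorphic_on ball 0 1"
    using hol sub by (auto intro: holomorphic_on_subset)
  have cont: "continuous_on (cball 0 1) f" "continuous_on (cball 0 1) g"
    using hol sub by (auto intro: continuous_on_subset holomorphic_on_imp_continuous_on)
  have "finite {z \<in> ball 0 1. f z = 0}"
  proof (cases "f constant_on ball 0 R")
    case True
    then have "f z = of_real p" if "z \<in> ball 0 1" for z
      using f0 that sub R unfolding constant_on_def by (metis centre_in_ball less_trans subsetD zero_less_one)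
    then have "{z \<in> ball 0 1. f z = 0} = {}" using p by auto
    then show ?thesis by (simp only: finite.emptyI)
  next
    case False
    have "finite {z \<in> cball 0 1. f z = 0}"
      by (rule holomorphic_compact_finite_zeros[OF hol(1)]) (use False sub in auto)
    then show ?thesis by (rule rev_finite_subset) auto
  qed
  then obtain B h where B: "B holomorphic_on ball 0 1" "\<And>z. z \<in> ball 0 1 \<Longrightarrow> cmod (B z) \<le> 1"
    and h: "h holomorphic_on ball 0 1" "continuous_on (cball 0 1) h"
      "\<And>z. z \<in> ball 0 1 \<Longrightarrow> h z \<noteq> 0" "\<And>z. z \<in> sphere 0 1 \<Longrightarrow> cmod (h z) = cmod (f z)"
    and fBh: "\<And>z. z \<in> ball 0 1 \<Longrightarrow> f z = B z * h z"
    by (rule blaschke_factorization[OF _ hol1(1) cont(1)]) (use f0 p in auto)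
  obtain L where L: "L holomorphic_on ball 0 1" "\<And>z. z \<in> ball 0 1 \<Longrightarrow> h z = exp (L z)"
    using contractible_imp_holomorphic_log[OF h(1) convex_imp_contractible[OF convex_ball] h(3)] by blast
  define \<phi> where "\<phi> = (\<lambda>z. of_real m * L z)"
  have hol\<phi>: "\<phi> holomorphic_on ball 0 1" unfolding \<phi>_def by (intro holomorphic_intros L)
  have h_powr: "cmod (h z) powr (2 * m) = exp (2 * Re (\<phi> z))" if "z \<in> ball 0 1" for z
    using L(2)[OF that] by (simp add: \<phi>_def powr_def algebra_simps)
  have exp_le: "exp (2 * Re (\<phi> z)) + (cmod (g z))\<^sup>2 \<le> 1" if "z \<in> ball 0 1" for z
  proof -
    have "(cmod (exp (\<phi> z)))\<^sup>2 + (cmod (g z))\<^sup>2 \<le> 1"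
    proof (rule pair_maximum_principle[where k = "\<lambda>z. exp (\<phi> z)" and g = g and \<Psi> = "\<lambda>z. cmod (h z) powr (2 * m) + (cmod (g z))\<^sup>2"])
      show "(\<lambda>z. exp (\<phi> z)) holomorphic_on ball 0 1" by (intro holomorphic_intros hol\<phi>)
      show "continuous_on (cball 0 1) (\<lambda>z. cmod (h z) powr (2 * m) + (cmod (g z))\<^sup>2)"
        using m by (intro continuous_intros continuous_on_powr' h cont) auto
      show "cmod (h z) powr (2 * m) + (cmod (g z))\<^sup>2 = (cmod (exp (\<phi> z)))\<^sup>2 + (cmod (g z))\<^sup>2"
        if "z \<in> ball 0 1" for z
        using h_powr[OF that] by (simp add: exp_double[symmetric])
      show "cmod (h z) powr (2 * m) + (cmod (g z))\<^sup>2 \<le> 1" if "z \<in> sphere 0 1" for z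
        using le[of z] h(4)[OF that] that R by simp
    qed (use hol1 that in auto)
    then show ?thesis by (simp add: exp_double[symmetric])
  qed
  define a where "a = cmod (B 0)"
  define q where "q = exp (2 * Re (\<phi> 0))"
  define W where "W = cmod (deriv \<phi> 0)"
  have p_ah: "p = a * cmod (h 0)"
    using fBh[of 0] f0 p by (metis a_def centre_in_ball norm_mult norm_of_real abs_of_pos zero_less_one)
  have a: "0 < a" "a \<le> 1" using p_ah p B(2)[of 0] by (auto simp: a_def)
  have h0: "cmod (h 0) = p / a" using p_ah a by simp
  have q_eq: "(p / a) powr (2 * m) = q" using h_powr[of 0] h0 by (simp add: q_def)
  have "(p / a) powr (2 * m) \<le> 1" using exp_le[of 0] g0 q_eq by (simp add: q_def)
  then have "p / a \<le> 1" using gr_one_powr[of "p / a" "2 * m"] m by linarith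
  then have pa: "p \<le> a" using a by simp
  have "cmod (deriv f 0) \<le> p * ((1 - a\<^sup>2) / a + W / m)"
  proof -
    have dB: "(B has_field_derivative deriv B 0) (at 0)" and dL: "(L has_field_derivative deriv L 0) (at 0)"
      using B L by (auto intro!: holomorphic_derivI[of _ "ball 0 1"])
    have "deriv \<phi> 0 = of_real m * deriv L 0"
      unfolding \<phi>_def by (intro DERIV_imp_deriv DERIV_cmult dL)
    then have W: "W = m * cmod (deriv L 0)" using m by (simp add: W_def norm_mult)
    have "((\<lambda>z. B z * exp (L z)) has_field_derivative B 0 * (exp (L 0) * deriv L 0) + deriv B 0 * exp (L 0)) (at 0)"
      by (rule DERIV_mult'[OF dB DERIV_chain2[OF DERIV_exp dL]])
    then have "(f has_field_derivative B 0 * (exp (L 0) * deriv L 0) + deriv B 0 * exp (L 0)) (at 0)"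
      by (rule has_field_derivative_transform_within_open[of _ _ _ "ball 0 1"]) (auto simp: fBh L)
    then have "deriv f 0 = h 0 * (B 0 * deriv L 0 + deriv B 0)"
      using L(2)[of 0] by (simp add: DERIV_imp_deriv algebra_simps)
    then have "cmod (deriv f 0) = (p / a) * cmod (B 0 * deriv L 0 + deriv B 0)"
      by (simp add: norm_mult h0)
    also have "\<dots> \<le> (p / a) * (a * cmod (deriv L 0) + (1 - a\<^sup>2))"
    proof (rule mult_left_mono)
      have "cmod (deriv B 0) \<le> 1 - a\<^sup>2" using schwarz_pick_0[OF B] by (simp add: a_def)
      then show "cmod (B 0 * deriv L 0 + deriv B 0) \<le> a * cmod (deriv L 0) + (1 - a\<^sup>2)"
        using norm_triangle_ineq[of "B 0 * deriv L 0" "deriv B 0"] by (simp add: norm_mult a_def)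
    qed (use p a in auto)
    also have "\<dots> = p * ((1 - a\<^sup>2) / a + W / m)" using a m W by (simp add: field_simps)
    finally show ?thesis .
  qed
  moreover have "q * W\<^sup>2 + (1 - q) * G\<^sup>2 \<le> (1 - q)\<^sup>2" "G\<^sup>2 \<le> 1 - q"
  proof -
    have k: "(\<lambda>z. exp (\<phi> z)) holomorphic_on ball 0 1" by (intro holomorphic_intros hol\<phi>)
    have kle: "(cmod (exp (\<phi> z)))\<^sup>2 + (cmod (g z))\<^sup>2 \<le> 1" if "z \<in> ball 0 1" for z
      using exp_le[OF that] by (simp add: exp_double[symmetric])
    have "(\<phi> has_field_derivative deriv \<phi> 0) (at 0)"
      using hol\<phi> by (auto intro!: holomorphic_derivI[of _ "ball 0 1"])
    then have dk: "deriv (\<lambda>z. exp (\<phi> z)) 0 = exp (\<phi> 0) * deriv \<phi> 0"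
      by (intro DERIV_imp_deriv DERIV_chain2[OF DERIV_exp])
    have q': "q = (cmod (exp (\<phi> 0)))\<^sup>2" by (simp add: q_def exp_double[symmetric])
    show "q * W\<^sup>2 + (1 - q) * G\<^sup>2 \<le> (1 - q)\<^sup>2"
      using ball_schwarz(1)[OF k hol1(2) kle g0] unfolding q' dk W_def G
      by (simp add: norm_mult power_mult_distrib)
    show "G\<^sup>2 \<le> 1 - q"
      using ball_schwarz(2)[OF k hol1(2) kle g0] unfolding q' G by simp
  qed
  moreover have "W \<le> G + ln ((1 - G) / q)" if "0 < G" "G \<le> 1 - q"
    using log_schwarz[OF hol\<phi> hol1(2) exp_le g0 q_def G that] by (simp add: W_def)
  ultimately show thesis using that[of a W] pa a by (simp add: W_def q_eq)
qed

section \<open>The envelope\<close>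

locale ellipsoid_point =
  fixes m p :: real
  assumes m: "0 < m" "m < 1 / 2" and p: "0 < p" "p < 1"
begin

text \<open>
  A disc with first component \<open>f\<close> and Blaschke modulus \<open>x\<close> as above has the two invariants
  \<open>V = |f'(0)| / p\<close> and \<open>G\<close>, the norm of the derivative of the other components. The discs with
  \<open>h\<^sup>m = q\<^sup>1\<^sup>/\<^sup>2 (1 - x \<zeta>) / (1 - x q \<zeta>)\<close> realize the envelope \<open>(envV x, envG2 x)\<close> of the admissible
  regions in the plane of \<open>(V, G\<^sup>2)\<close>. Its singular point is at \<open>x = cusp\<close>.
\<close>

definition P :: real where "P = p powr (2 * m)"
definition q :: "real \<Rightarrow> real" where "q x = (p / x) powr (2 * m)"
definition envV :: "real \<Rightarrow> real" where "envV x = (1 - x\<^sup>2) / x + x * (1 - q x) / m"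
definition envG2 :: "real \<Rightarrow> real" where "envG2 x = (1 - q x) * (1 - x\<^sup>2 * q x)"
definition slope :: "real \<Rightarrow> real" where "slope x = m / x\<^sup>2 - (1 - m) + (1 - 2 * m) * q x"
definition cusp :: real where "cusp = (SOME x. p < x \<and> x < 1 \<and> slope x = 0)"

lemma P_bounds: "0 < P" "P < 1"
  using p m powr_less_mono2[of "2 * m" p 1] by (auto simp: P_def)

lemma q_eq: "x > 0 \<Longrightarrow> q x = P / x powr (2 * m)"
  using p by (simp add: q_def P_def powr_divide)

lemma q_pos: "x > 0 \<Longrightarrow> q x > 0"
  using p by (simp add: q_def)

lemma q_deriv:
  assumes "x > 0"
  shows "(q has_real_derivative - (2 * m) * q x / x) (at x)"
proof -
  have "((\<lambda>x. p / x) has_real_derivative - p / x\<^sup>2) (at x)"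
    using assms by (auto intro!: derivative_eq_intros simp: power2_eq_square)
  then have "((\<lambda>x. (p / x) powr (2 * m)) has_real_derivative
      2 * m * (p / x) powr (2 * m - of_nat 1) * (- p / x\<^sup>2)) (at x)"
    using assms p by (intro DERIV_fun_powr) auto
  moreover have "(p / x) powr (2 * m - of_nat 1) = q x / (p / x)"
    using assms p by (simp add: q_def powr_diff)
  moreover have "2 * m * (q x / (p / x)) * (- p / x\<^sup>2) = - (2 * m) * q x / x"
    using assms p by (simp add: field_simps power2_eq_square)
  moreover have "q = (\<lambda>x. (p / x) powr (2 * m))" by (simp add: q_def fun_eq_iff)
  ultimately show ?thesis by metis
qed

lemma q_strict_antimono: "0 < x \<Longrightarrow> x < y \<Longrightarrow> q y < q x"
  unfolding q_def using p m by (intro powr_less_mono2) (auto simp: field_simps)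

lemma q_antimono: "0 < x \<Longrightarrow> x \<le> y \<Longrightarrow> q y \<le> q x"
  using q_strict_antimono[of x y] by (cases "x = y") auto

lemma q_p: "q p = 1" and q_1: "q 1 = P"
  using p by (auto simp: q_def P_def)

lemma q_le_1: "p \<le> x \<Longrightarrow> q x \<le> 1"
  using q_antimono[of p x] p by (simp add: q_p)

lemma q_less_1: "p < x \<Longrightarrow> q x < 1"
  using q_strict_antimono[of p x] p by (simp add: q_p)

lemma q_cont: "continuous_on {x. 0 < x} q"
  by (intro continuous_at_imp_continuous_on ballI) (auto intro: DERIV_isCont[OF q_deriv])

lemma q_cont_on: "a > 0 \<Longrightarrow> continuous_on {a..b} q"
  by (rule continuous_on_subset[OF q_cont]) auto

lemma slope_cont_on: "a > 0 \<Longrightarrow> continuous_on {a..b} slope"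
  unfolding slope_def by (intro continuous_intros q_cont_on) auto

lemma envG2_cont_on: "a > 0 \<Longrightarrow> continuous_on {a..b} envG2"
  unfolding envG2_def by (intro continuous_intros q_cont_on) auto

lemma slope_strict_antimono: "0 < x \<Longrightarrow> x < y \<Longrightarrow> slope y < slope x"
proof -
  assume xy: "0 < x" "x < y"
  then have "x\<^sup>2 < y\<^sup>2" by (intro power_strict_mono) auto
  then have "m / y\<^sup>2 < m / x\<^sup>2" using xy m by (intro divide_strict_left_mono) auto
  moreover have "(1 - 2 * m) * q y < (1 - 2 * m) * q x"
    using m q_strict_antimono[OF xy] by (intro mult_strict_left_mono) auto
  ultimately show ?thesis by (simp add: slope_def)
qed

lemma cusp: "p < cusp" "cusp < 1" "slope cusp = 0"
proof -
  have "slope p > 0"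
  proof -
    have "p\<^sup>2 < 1" using p by (simp add: power_less_one_iff)
    then have "m / p\<^sup>2 > m" using m p by (simp add: field_simps)
    then show ?thesis by (simp add: slope_def q_p)
  qed
  moreover have "slope 1 < 0"
  proof -
    have "(1 - 2 * m) * P < (1 - 2 * m) * 1" using m P_bounds by (intro mult_strict_left_mono) auto
    then show ?thesis by (simp add: slope_def q_1)
  qed
  moreover have "\<exists>x\<ge>p. x \<le> 1 \<and> slope x = 0"
    by (rule IVT2') (use p calculation slope_cont_on in auto)
  then obtain x where x: "p \<le> x" "x \<le> 1" "slope x = 0" by blast
  moreover have "x \<noteq> p" "x \<noteq> 1" using x(3) calculation(1,2) by auto
  ultimately have "p < x \<and> x < 1 \<and> slope x = 0" by simp
  then have "p < cusp \<and> cusp < 1 \<and> slope cusp = 0"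
    unfolding cusp_def by (rule someI)
  then show "p < cusp" "cusp < 1" "slope cusp = 0" by auto
qed

lemma slope_pos_iff: "x > 0 \<Longrightarrow> 0 < slope x \<longleftrightarrow> x < cusp"
  and slope_neg_iff: "x > 0 \<Longrightarrow> slope x < 0 \<longleftrightarrow> cusp < x"
  using slope_strict_antimono[of x cusp] slope_strict_antimono[of cusp x] cusp p
  by (smt (verit))+

lemma envV_deriv: "x > 0 \<Longrightarrow> (envV has_real_derivative - slope x / m) (at x)"
  unfolding envV_def slope_def using m
  by (auto intro!: derivative_eq_intros q_deriv simp: field_simps power2_eq_square)

lemma envG2_deriv: "x > 0 \<Longrightarrow> (envG2 has_real_derivative 2 * q x * x * slope x) (at x)"
  unfolding envG2_def slope_def using m
  by (auto intro!: derivative_eq_intros q_deriv simp: field_simps power2_eq_square)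

lemma envV_less:
  assumes xy: "0 < x" "x < y" "y \<le> cusp"
  shows "envV y < envV x"
proof (rule DERIV_neg_imp_decreasing_open[of x y envV])
  fix z assume "x < z" "z < y"
  then have z: "z > 0" "slope z > 0" using xy slope_pos_iff[of z] by auto
  show "\<exists>d. (envV has_real_derivative d) (at z) \<and> d < 0"
    using envV_deriv[OF z(1)] z m by (intro exI[of _ "- slope z / m"]) simp
next
  show "continuous_on {x..y} envV"
    unfolding envV_def using xy m by (intro continuous_intros q_cont_on) auto
qed (rule xy)

lemma envG2_less:
  assumes xy: "0 < x" "x < y" "y \<le> cusp"
  shows "envG2 x < envG2 y"
proof (rule DERIV_pos_imp_increasing_open[of x y envG2])
  fix z assume "x < z" "z < y"
  then have z: "z > 0" "slope z > 0" using xy slope_pos_iff[of z] by auto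
  show "\<exists>d. (envG2 has_real_derivative d) (at z) \<and> d > 0"
    using envG2_deriv[OF z(1)] z q_pos by (intro exI[of _ "2 * q z * z * slope z"]) simp
qed (use xy envG2_cont_on in auto)

lemma envG2_greater:
  assumes xy: "cusp \<le> x" "x < y"
  shows "envG2 y < envG2 x"
proof (rule DERIV_neg_imp_decreasing_open[of x y envG2])
  have x: "x > 0" using xy cusp p by simp
  then show "continuous_on {x..y} envG2" by (rule envG2_cont_on)
  fix z assume "x < z" "z < y"
  then have z: "z > 0" "slope z < 0" using xy x slope_neg_iff[of z] by auto
  show "\<exists>d. (envG2 has_real_derivative d) (at z) \<and> d < 0"
    using envG2_deriv[OF z(1)] z q_pos
    by (intro exI[of _ "2 * q z * z * slope z"]) (simp add: mult_less_0_iff)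
qed (rule xy)

lemma envG2_mono: "0 < x \<Longrightarrow> x \<le> y \<Longrightarrow> y \<le> cusp \<Longrightarrow> envG2 x \<le> envG2 y"
  using envG2_less[of x y] by (cases "x = y") auto

lemma envG2_antimono: "cusp \<le> x \<Longrightarrow> x \<le> y \<Longrightarrow> envG2 y \<le> envG2 x"
  using envG2_greater[of x y] by (cases "x = y") auto

lemma envG2_le_cusp: "x > 0 \<Longrightarrow> envG2 x \<le> envG2 cusp"
  using envG2_mono[of x cusp] envG2_antimono[of cusp x] by (cases "x \<le> cusp") auto

lemma envG2_p: "envG2 p = 0" and envG2_1: "envG2 1 = (1 - P)\<^sup>2" and envV_1: "envV 1 = (1 - P) / m"
  by (auto simp: envG2_def envV_def q_p q_1 power2_eq_square)

lemma envG2_pos: "p < x \<Longrightarrow> x \<le> 1 \<Longrightarrow> 0 < envG2 x"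
proof -
  assume x: "p < x" "x \<le> 1"
  have "x\<^sup>2 * q x < 1" using x q_less_1[of x] q_pos[of x] p power_le_one[of x 2]
    by (smt (verit) mult_left_le_one_le zero_le_power2)
  then show ?thesis using q_less_1[of x] x by (simp add: envG2_def)
qed

lemma envV_pos: "p \<le> x \<Longrightarrow> x \<le> 1 \<Longrightarrow> 0 < envV x"
proof -
  assume x: "p \<le> x" "x \<le> 1"
  show ?thesis
  proof (cases "x = 1")
    case True then show ?thesis using P_bounds m by (simp add: envV_1)
  next
    case False
    then have "x\<^sup>2 < 1" using x p by (simp add: power_less_one_iff)
    then have "(1 - x\<^sup>2) / x > 0" "x * (1 - q x) / m \<ge> 0" using x p m q_le_1[of x] by auto
    then show ?thesis by (simp add: envV_def)
  qed
qed

text \<open>The largest \<open>V\<close> that the ball estimate admits for given \<open>G\<close> and Blaschke modulus \<open>x\<close>.\<close>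

definition fibre :: "real \<Rightarrow> real \<Rightarrow> real" where
  "fibre G x = (1 - x\<^sup>2) / x + sqrt ((1 - G\<^sup>2 - q x) / q x * (1 - q x)) / m"

lemma fibre_deriv:
  assumes x: "p < x" "G\<^sup>2 < 1 - q x"
  defines "\<alpha> \<equiv> sqrt ((1 - G\<^sup>2 - q x) / q x)" and "\<beta> \<equiv> sqrt (1 - q x)"
  shows "(fibre G has_real_derivative (x * \<alpha> - \<beta>) * (\<alpha> - x * \<beta>) / (x\<^sup>2 * \<alpha> * \<beta>)) (at x)"
proof -
  have x0: "x > 0" and q: "q x > 0" "q x < 1" using x p q_pos q_less_1 by auto
  define A where "A = (1 - G\<^sup>2 - q x) / q x"
  define B where "B = 1 - q x"
  have AB: "A > 0" "B > 0" using x q by (auto simp: A_def B_def)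
  have \<alpha>: "\<alpha> > 0" "\<alpha>\<^sup>2 = A" and \<beta>: "\<beta> > 0" "\<beta>\<^sup>2 = B"
    using AB by (auto simp: \<alpha>_def \<beta>_def A_def B_def)
  have "((\<lambda>x. (1 - G\<^sup>2 - q x) / q x * (1 - q x)) has_real_derivative 2 * m * (A + B) / x) (at x)"
    using x0 q by (auto intro!: derivative_eq_intros q_deriv simp: A_def B_def field_simps power2_eq_square)
  moreover have "(sqrt has_real_derivative inverse (sqrt (A * B)) / 2)
      (at ((1 - G\<^sup>2 - q x) / q x * (1 - q x)))"
    using DERIV_real_sqrt[OF mult_pos_pos[OF AB]] unfolding A_def B_def .
  ultimately have "((\<lambda>x. sqrt ((1 - G\<^sup>2 - q x) / q x * (1 - q x))) has_real_derivative
      inverse (sqrt (A * B)) / 2 * (2 * m * (A + B) / x)) (at x)"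
    by (rule DERIV_chain2[rotated])
  moreover have "((\<lambda>x. (1 - x\<^sup>2) / x) has_real_derivative - 1 / x\<^sup>2 - 1) (at x)"
    using x0 by (auto intro!: derivative_eq_intros simp: field_simps power2_eq_square)
  ultimately have "(fibre G has_real_derivative
      - 1 / x\<^sup>2 - 1 + inverse (sqrt (A * B)) / 2 * (2 * m * (A + B) / x) / m) (at x)"
    unfolding fibre_def by (intro DERIV_add DERIV_cdivide)
  moreover have "sqrt (A * B) = \<alpha> * \<beta>"
    unfolding \<alpha>_def \<beta>_def A_def B_def by (rule real_sqrt_mult)
  then have "- 1 / x\<^sup>2 - 1 + inverse (sqrt (A * B)) / 2 * (2 * m * (A + B) / x) / m
     = (x * \<alpha> - \<beta>) * (\<alpha> - x * \<beta>) / (x\<^sup>2 * \<alpha> * \<beta>)"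
    using \<alpha> \<beta> x0 m unfolding \<alpha>(2)[symmetric] \<beta>(2)[symmetric]
    by (simp add: field_simps power2_eq_square)
  ultimately show ?thesis by simp
qed

lemma fibre_cont_on: "a > 0 \<Longrightarrow> continuous_on {a..b} (fibre G)"
  unfolding fibre_def using m q_pos by (intro continuous_intros q_cont_on) (auto simp: less_imp_neq[symmetric])

lemma fibre_decreasing:
  assumes ab: "p < a" "a \<le> b" "b \<le> 1" and G: "0 < G" "1 - q b \<le> G" "G\<^sup>2 < 1 - q a"
    and le: "\<And>x. a < x \<Longrightarrow> x < b \<Longrightarrow> G\<^sup>2 \<le> envG2 x"
  shows "fibre G b \<le> fibre G a"
proof (rule DERIV_nonpos_imp_decreasing_open[OF ab(2)])
  show "continuous_on {a..b} (fibre G)" using ab p by (intro fibre_cont_on) auto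
  fix x assume x: "a < x" "x < b"
  define A where "A = (1 - G\<^sup>2 - q x) / q x"
  define B where "B = 1 - q x"
  have x0: "x > 0" using x ab p by simp
  have q: "q x > 0" "q x < 1" "q b < q x" "q x < q a"
    using x ab p q_pos[of x] q_less_1[of x] q_strict_antimono by auto
  have G2: "G\<^sup>2 < 1 - q x" using G q by simp
  have "(1 - q x)\<^sup>2 \<le> G\<^sup>2" using q G by (intro power_mono) auto
  then have AB: "A \<le> B" using q by (simp add: A_def B_def field_simps power2_eq_square)
  have "x\<^sup>2 * B \<le> A" using le[OF x] q
    by (simp add: A_def B_def envG2_def field_simps power2_eq_square)
  then have "sqrt (x\<^sup>2 * B) \<le> sqrt A" by simp
  then have 1: "x * sqrt B \<le> sqrt A" using x0 by (simp add: real_sqrt_mult)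
  have "x * sqrt A \<le> 1 * sqrt A" using x ab A_def G2 q by (intro mult_right_mono) auto
  also have "\<dots> \<le> sqrt B" using AB by simp
  finally have 2: "x * sqrt A \<le> sqrt B" .
  have pos: "sqrt A > 0" "sqrt B > 0" using G2 q by (auto simp: A_def B_def)
  have "(x * sqrt A - sqrt B) * (sqrt A - x * sqrt B) / (x\<^sup>2 * sqrt A * sqrt B) \<le> 0"
    using 1 2 pos x0 by (intro divide_nonpos_pos mult_nonpos_nonneg) auto
  moreover have "(fibre G has_real_derivative
      (x * sqrt A - sqrt B) * (sqrt A - x * sqrt B) / (x\<^sup>2 * sqrt A * sqrt B)) (at x)"
    using fibre_deriv[of x G] x ab G2 by (simp add: A_def B_def)
  ultimately show "\<exists>y. (fibre G has_real_derivative y) (at x) \<and> y \<le> 0" by blast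
qed

lemma fibre_increasing:
  assumes ab: "p < a" "a \<le> b" "b \<le> 1" and G: "G\<^sup>2 \<le> 1 - q a"
    and le: "\<And>x. a < x \<Longrightarrow> x < b \<Longrightarrow> envG2 x \<le> G\<^sup>2"
  shows "fibre G a \<le> fibre G b"
proof (rule DERIV_nonneg_imp_increasing_open[OF ab(2)])
  show "continuous_on {a..b} (fibre G)" using ab p by (intro fibre_cont_on) auto
  fix x assume x: "a < x" "x < b"
  define A where "A = (1 - G\<^sup>2 - q x) / q x"
  define B where "B = 1 - q x"
  have x0: "x > 0" "x < 1" using x ab p by auto
  have q: "q x > 0" "q x < 1" "q x < q a"
    using x ab p q_pos[of x] q_less_1[of x] q_strict_antimono by auto
  have G2: "G\<^sup>2 < 1 - q x" using G q by simp
  have pos: "sqrt A > 0" "sqrt B > 0" using G2 q by (auto simp: A_def B_def)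
  have "A \<le> x\<^sup>2 * B" using le[OF x] q
    by (simp add: A_def B_def envG2_def field_simps power2_eq_square)
  then have "sqrt A \<le> sqrt (x\<^sup>2 * B)" by simp
  then have 1: "sqrt A \<le> x * sqrt B" using x0 by (simp add: real_sqrt_mult)
  have "x * sqrt A \<le> x * (x * sqrt B)" using 1 x0 by (intro mult_left_mono) auto
  also have "\<dots> \<le> sqrt B" using x0 pos mult_le_one[of x x] by (simp add: mult_le_cancel_right1 mult.assoc[symmetric])
  finally have 2: "x * sqrt A \<le> sqrt B" .
  have "(x * sqrt A - sqrt B) * (sqrt A - x * sqrt B) / (x\<^sup>2 * sqrt A * sqrt B) \<ge> 0"
    using 1 2 pos x0 by (intro divide_nonneg_pos mult_nonpos_nonpos) auto
  moreover have "(fibre G has_real_derivative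
      (x * sqrt A - sqrt B) * (sqrt A - x * sqrt B) / (x\<^sup>2 * sqrt A * sqrt B)) (at x)"
    using fibre_deriv[of x G] x ab G2 by (simp add: A_def B_def)
  ultimately show "\<exists>y. (fibre G has_real_derivative y) (at x) \<and> y \<ge> 0" by blast
qed

lemma fibre_at_envelope:
  assumes x: "p < x" and G: "envG2 x = G\<^sup>2"
  shows "fibre G x = envV x" "G\<^sup>2 < 1 - q x"
proof -
  have q: "0 < q x" "q x < 1" and x0: "x > 0" using x p q_pos q_less_1 by auto
  have "1 - G\<^sup>2 - q x = x\<^sup>2 * q x * (1 - q x)"
    using G by (simp add: envG2_def algebra_simps power2_eq_square)
  then have "(1 - G\<^sup>2 - q x) / q x * (1 - q x) = (x * (1 - q x))\<^sup>2"
    using q by (simp add: power2_eq_square)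
  then have "sqrt ((1 - G\<^sup>2 - q x) / q x * (1 - q x)) = x * (1 - q x)"
    using q x0 by simp
  then show "fibre G x = envV x" by (simp add: fibre_def envV_def)
  have "x\<^sup>2 * q x * (1 - q x) > 0" using q x0 by simp
  then show "G\<^sup>2 < 1 - q x" using \<open>1 - G\<^sup>2 - q x = x\<^sup>2 * q x * (1 - q x)\<close> by linarith
qed

lemma fibre_bound:
  assumes a: "p < a" "a \<le> 1" and G: "0 < G" "1 - q a \<le> G" "G\<^sup>2 \<le> 1 - q a"
  shows "(\<exists>b. p < b \<and> b \<le> cusp \<and> envG2 b = G\<^sup>2 \<and> fibre G a \<le> envV b)
    \<or> (1 - P < G \<and> G\<^sup>2 \<le> 1 - P \<and> fibre G a \<le> fibre G 1)"
proof -
  have cusp0: "cusp > 0" using cusp p by simp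
  have a0: "a > 0" using a p by simp
  show ?thesis
  proof (cases "G\<^sup>2 \<le> envG2 a")
    case True
    have "\<exists>b\<ge>p. b \<le> min a cusp \<and> envG2 b = G\<^sup>2"
    proof (rule IVT')
      show "envG2 p \<le> G\<^sup>2" by (simp add: envG2_p)
      show "G\<^sup>2 \<le> envG2 (min a cusp)" using True envG2_le_cusp[of a] a0 by (simp add: min_def)
      show "p \<le> min a cusp" using a cusp by simp
      show "continuous_on {p..min a cusp} envG2" using p by (intro envG2_cont_on)
    qed
    then obtain b where b: "p \<le> b" "b \<le> a" "b \<le> cusp" "envG2 b = G\<^sup>2" by auto
    have "b \<noteq> p" using b G envG2_p by auto
    then have pb: "p < b" using b by simp
    have "fibre G a \<le> fibre G b"
    proof (rule fibre_decreasing[OF pb b(2) a(2) G(1,2) fibre_at_envelope(2)[OF pb b(4)]])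
      fix x assume x: "b < x" "x < a"
      show "G\<^sup>2 \<le> envG2 x"
      proof (cases "x \<le> cusp")
        case True then show ?thesis using envG2_mono[of b x] x pb p b(4) by simp
      next
        case False then show ?thesis using envG2_antimono[of x a] x True by simp
      qed
    qed
    then show ?thesis using fibre_at_envelope(1)[OF pb b(4)] pb b by auto
  next
    case False
    show ?thesis
    proof (cases "a \<le> cusp \<and> G\<^sup>2 \<le> envG2 cusp")
      case True
      have "\<exists>b\<ge>a. b \<le> cusp \<and> envG2 b = G\<^sup>2"
        by (rule IVT') (use False True a0 in \<open>auto intro: envG2_cont_on\<close>)
      then obtain b where b: "a \<le> b" "b \<le> cusp" "envG2 b = G\<^sup>2" by auto
      have pb: "p < b" using a b by simp
      have "fibre G a \<le> fibre G b"
      proof (rule fibre_increasing[OF a(1) b(1) _ G(3)])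
        show "b \<le> 1" using b cusp by simp
        show "envG2 x \<le> G\<^sup>2" if "a < x" "x < b" for x
          using envG2_mono[of x b] that a0 b by simp
      qed
      then show ?thesis using fibre_at_envelope(1)[OF pb b(3)] pb b by auto
    next
      case nc: False
      have lt: "envG2 x < G\<^sup>2" if "a \<le> x" for x
      proof (cases "a \<le> cusp")
        case True
        then show ?thesis using nc envG2_le_cusp[of x] that a0 by simp
      next
        case f: False
        then show ?thesis using False envG2_antimono[of a x] that by simp
      qed
      have "fibre G a \<le> fibre G 1"
        by (rule fibre_increasing[OF a(1,2) order_refl G(3)]) (use lt in \<open>auto intro: less_imp_le\<close>)
      moreover have "1 - P < G"
        using lt[of 1] a(2) G(1) by (simp add: envG2_1 power2_less_imp_less)
      moreover have "G\<^sup>2 \<le> 1 - P" using G(3) q_antimono[of a 1] a a0 by (simp add: q_1)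
      ultimately show ?thesis by blast
    qed
  qed
qed

lemma feasible_bound:
  assumes a: "p \<le> a" "a \<le> 1" and G: "0 < G" and W: "0 \<le> W" and V: "0 \<le> V" "V \<le> (1 - a\<^sup>2) / a + W / m"
    and ball: "q a * W\<^sup>2 + (1 - q a) * G\<^sup>2 \<le> (1 - q a)\<^sup>2" "G\<^sup>2 \<le> 1 - q a"
    and log: "G \<le> 1 - q a \<Longrightarrow> W \<le> G + ln ((1 - G) / q a)"
  shows "(\<exists>b. p < b \<and> b \<le> cusp \<and> envG2 b = G\<^sup>2 \<and> V \<le> envV b)
    \<or> (1 - P < G \<and> P * (m * V)\<^sup>2 + (1 - P) * G\<^sup>2 \<le> (1 - P)\<^sup>2)"
proof -
  have a0: "a > 0" using a p by simp
  have "G\<^sup>2 > 0" using G by simp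
  then have qa: "q a > 0" "q a < 1" using q_pos[OF a0] ball(2) by linarith+
  have pa: "p < a" using qa q_p a by (metis less_le order_less_irrefl)
  have "\<exists>a1. p < a1 \<and> a1 \<le> 1 \<and> 1 - q a1 \<le> G \<and> G\<^sup>2 \<le> 1 - q a1 \<and> V \<le> fibre G a1"
  proof (cases "G \<le> 1 - q a")
    case True
    have G1: "G < 1" using True qa by simp
    define a1 where "a1 = p / (1 - G) powr (1 / (2 * m))"
    have a1: "a1 > 0" using p G1 by (simp add: a1_def)
    have qa1: "q a1 = 1 - G" using G1 p m by (simp add: q_def a1_def powr_powr)
    have "a1 \<le> a" using q_strict_antimono[OF a0, of a1] True qa1 by linarith
    moreover have "p < a1" using q_antimono[OF a1, of p] qa1 G q_p by linarith
    moreover have "G\<^sup>2 \<le> 1 - q a1" using G G1 by (simp add: qa1 power2_eq_square)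
    moreover have "V \<le> fibre G a1"
    proof -
      define H where "H = (\<lambda>x::real. (1 - x\<^sup>2) / x + 2 * ln x)"
      have "H a \<le> H a1"
      proof (rule DERIV_nonpos_imp_nonincreasing[OF \<open>a1 \<le> a\<close>])
        fix x assume "a1 \<le> x"
        then have x: "x > 0" using a1 by simp
        then have "(H has_real_derivative - (1 / x - 1)\<^sup>2) (at x)"
          unfolding H_def by (auto intro!: derivative_eq_intros simp: field_simps power2_eq_square)
        then show "\<exists>y. (H has_real_derivative y) (at x) \<and> y \<le> 0" by (intro exI) auto
      qed
      have lnq: "ln (q x) = 2 * m * (ln p - ln x)" if "x > 0" for x
        using that p by (simp add: q_def ln_powr ln_div)
      have "W / m \<le> (G + ln (1 - G) - ln (q a)) / m"
        using log[OF True] m G1 qa by (intro divide_right_mono) (auto simp: ln_div)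
      then have "V \<le> (1 - a\<^sup>2) / a + (G + ln (1 - G) - ln (q a)) / m" using V by linarith
      also have "\<dots> = H a + (G + ln (1 - G)) / m - 2 * ln p"
        using m by (simp add: H_def lnq[OF a0] field_simps)
      also have "\<dots> \<le> H a1 + (G + ln (1 - G)) / m - 2 * ln p" using \<open>H a \<le> H a1\<close> by simp
      also have "\<dots> = (1 - a1\<^sup>2) / a1 + G / m"
        using m lnq[OF a1] qa1 by (simp add: H_def field_simps)
      also have "\<dots> = fibre G a1"
      proof -
        have "(1 - G\<^sup>2 - (1 - G)) / (1 - G) * (1 - (1 - G)) = G\<^sup>2"
          using G1 by (simp add: field_simps power2_eq_square)
        then show ?thesis using G by (simp add: fibre_def qa1)
      qed
      finally show ?thesis .
    qed
    ultimately show ?thesis using qa1 a by (intro exI[of _ a1]) auto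
  next
    case False
    have "W\<^sup>2 \<le> (1 - G\<^sup>2 - q a) / q a * (1 - q a)"
      using ball(1) qa by (simp add: field_simps power2_eq_square)
    then have "W \<le> sqrt ((1 - G\<^sup>2 - q a) / q a * (1 - q a))" by (rule real_le_rsqrt)
    then have "W / m \<le> sqrt ((1 - G\<^sup>2 - q a) / q a * (1 - q a)) / m" using m by (intro divide_right_mono) auto
    then have "V \<le> fibre G a" using V by (simp add: fibre_def)
    then show ?thesis using pa a False ball by (intro exI[of _ a]) auto
  qed
  then obtain a1 where a1: "p < a1" "a1 \<le> 1" "1 - q a1 \<le> G" "G\<^sup>2 \<le> 1 - q a1" "V \<le> fibre G a1"
    by blast
  from fibre_bound[OF a1(1,2) G a1(3,4)] show ?thesis
  proof (elim disjE exE conjE)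
    fix b assume "p < b" "b \<le> cusp" "envG2 b = G\<^sup>2" "fibre G a1 \<le> envV b"
    then show ?thesis using a1(5) by (intro disjI1 exI[of _ b]) auto
  next
    assume *: "1 - P < G" "G\<^sup>2 \<le> 1 - P" "fibre G a1 \<le> fibre G 1"
    define S where "S = (1 - G\<^sup>2 - P) / P * (1 - P)"
    have S: "S \<ge> 0" using * P_bounds by (simp add: S_def)
    have "V \<le> sqrt S / m" using * a1(5) by (simp add: fibre_def q_1 S_def)
    then have "m * V \<le> sqrt S" using m by (simp add: field_simps)
    then have "(m * V)\<^sup>2 \<le> S" using V m S by (simp add: real_le_rsqrt sqrt_ge_absD)
    then have "P * (m * V)\<^sup>2 \<le> P * S" using P_bounds by (intro mult_left_mono) auto
    also have "P * S = (1 - P)\<^sup>2 - (1 - P) * G\<^sup>2"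
      using P_bounds by (simp add: S_def field_simps power2_eq_square)
    finally show ?thesis using * by simp
  qed
qed

section \<open>Crossing of the envelope and the ball\<close>

definition tpar :: "real \<Rightarrow> real" where "tpar x = x\<^sup>2 * (1 - q x) / (1 - x\<^sup>2 * q x)"
definition ratio :: "real \<Rightarrow> real" where "ratio x = envG2 x / (m * envV x)\<^sup>2"

lemma x2q_less_1: "p \<le> x \<Longrightarrow> x < 1 \<Longrightarrow> x\<^sup>2 * q x < 1"
proof -
  assume x: "p \<le> x" "x < 1"
  have "x\<^sup>2 * q x \<le> x\<^sup>2" using q_le_1[OF x(1)] by (simp add: mult_left_le)
  also have "\<dots> < 1" using x p by (simp add: power_less_one_iff)
  finally show ?thesis .
qed

lemma alpha_sol_iff:
  assumes "p \<le> x" "x < 1"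
  shows "alpha_sol m p t x \<longleftrightarrow> t = tpar x"
proof -
  have x0: "x > 0" using assms p by simp
  have D: "1 - x\<^sup>2 * q x > 0" using x2q_less_1[OF assms] by simp
  define X where "X = x powr (2 * m)"
  have X: "X > 0" using x0 by (simp add: X_def)
  have qX: "q x = P / X" using q_eq[OF x0] by (simp add: X_def)
  have "x powr (2 * m - 2) = X / x\<^sup>2"
    using x0 by (simp add: X_def powr_diff)
  then have "alpha_sol m p t x \<longleftrightarrow> X - t * (X / x\<^sup>2) - (1 - t) * P = 0"
    using x0 assms by (simp add: alpha_sol_def X_def P_def)
  also have "\<dots> \<longleftrightarrow> x\<^sup>2 * (X - P) = t * (X - x\<^sup>2 * P)"
    using x0 by (simp add: field_simps)
  also have "\<dots> \<longleftrightarrow> x\<^sup>2 * (1 - q x) = t * (1 - x\<^sup>2 * q x)"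
    using X by (simp add: qX field_simps)
  also have "\<dots> \<longleftrightarrow> t = tpar x"
    using D by (auto simp: tpar_def field_simps)
  finally show ?thesis .
qed

lemma alpha_sol_unique:
  assumes t: "0 \<le> t" "t < 1"
  shows "\<exists>!x. alpha_sol m p t x" and "alpha_sol m p t x \<Longrightarrow> p \<le> x \<and> x < 1"
proof -
  define F where "F = (\<lambda>x. x powr (2 * m) - t * x powr (2 * m - 2) - (1 - t) * P)"
  have F_less: "F x < F y" if "0 < x" "x < y" for x y
  proof -
    have "x powr (2 * m) < y powr (2 * m)" using that m by (intro powr_less_mono2) auto
    moreover have "y powr (2 * m - 2) \<le> x powr (2 * m - 2)"
      using that m by (intro powr_mono2') auto
    then have "t * y powr (2 * m - 2) \<le> t * x powr (2 * m - 2)" using t by (intro mult_left_mono) auto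
    ultimately show ?thesis by (simp add: F_def)
  qed
  have Fp: "F p \<le> 0"
  proof -
    have "P * 1 \<le> P * (1 / p\<^sup>2)"
      using P_bounds p by (intro mult_left_mono) (auto simp: power_le_one)
    moreover have "p powr (2 * m - 2) = P / p\<^sup>2" using p by (simp add: powr_diff P_def)
    ultimately have "P \<le> p powr (2 * m - 2)" by simp
    then have "t * P \<le> t * p powr (2 * m - 2)" using t by (intro mult_left_mono) auto
    then show ?thesis by (simp add: F_def P_def[symmetric] left_diff_distrib)
  qed
  have "(1 - t) * P < (1 - t) * 1" using t P_bounds by (intro mult_strict_left_mono) auto
  then have F1: "F 1 > 0" by (simp add: F_def)
  have sol: "alpha_sol m p t x \<longleftrightarrow> 0 < x \<and> x < 1 \<and> F x = 0" for x
    by (simp add: alpha_sol_def F_def P_def)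
  have "\<exists>x\<ge>p. x \<le> 1 \<and> F x = 0"
  proof (rule IVT')
    show "continuous_on {p..1} F" unfolding F_def using p by (intro continuous_intros) auto
  qed (use Fp F1 p in auto)
  then obtain x where x: "p \<le> x" "x \<le> 1" "F x = 0" by blast
  moreover have "x \<noteq> 1" using x F1 by auto
  ultimately have "alpha_sol m p t x" using p sol by auto
  moreover have "y = z" if "alpha_sol m p t y" "alpha_sol m p t z" for y z
    using that F_less[of y z] F_less[of z y] sol by (cases y z rule: linorder_cases) auto
  ultimately show "\<exists>!x. alpha_sol m p t x" by blast
  show "p \<le> x \<and> x < 1" if "alpha_sol m p t x" for x
    using that F_less[of x p] Fp sol[of x] by (cases "p \<le> x") auto
qed

lemma tpar_le_iff:
  assumes "p \<le> x" "x < 1"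
  shows "tpar x \<le> m / (1 - m) \<longleftrightarrow> x \<le> cusp"
proof -
  have x0: "x > 0" using assms p by simp
  have D: "1 - x\<^sup>2 * q x > 0" using x2q_less_1[OF assms] by simp
  have "tpar x \<le> m / (1 - m) \<longleftrightarrow> x\<^sup>2 * (1 - q x) * (1 - m) \<le> m * (1 - x\<^sup>2 * q x)"
    using D m by (simp add: tpar_def divide_le_eq pos_le_divide_eq)
  also have "x\<^sup>2 * slope x = m * (1 - x\<^sup>2 * q x) - x\<^sup>2 * (1 - q x) * (1 - m)"
    using x0 by (simp add: slope_def field_simps)
  then have "x\<^sup>2 * (1 - q x) * (1 - m) \<le> m * (1 - x\<^sup>2 * q x) \<longleftrightarrow> 0 \<le> x\<^sup>2 * slope x" by simp
  also have "\<dots> \<longleftrightarrow> x \<le> cusp"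
    using slope_neg_iff[OF x0] x0 by (auto simp: zero_le_mult_iff not_less)
  finally show ?thesis .
qed

lemma tpar_env:
  assumes "p \<le> x" "x < 1"
  defines "t \<equiv> tpar x"
  shows "0 \<le> t" "t < 1"
    and "ratio x = t / (m + (1 - m) * t)\<^sup>2"
    and "envV x = (1 - x\<^sup>2) * (m * (1 - t) + t) / (m * x * (1 - t))"
proof -
  have x0: "x > 0" "x\<^sup>2 < 1" using assms p by (auto simp: power_less_one_iff)
  define D where "D = 1 - x\<^sup>2 * q x"
  have D: "D > 0" using x2q_less_1[OF assms(1,2)] by (simp add: D_def)
  have q: "q x \<le> 1" using q_le_1 assms by simp
  have t: "t * D = x\<^sup>2 * (1 - q x)" using D by (simp add: t_def tpar_def D_def)
  have t1: "(1 - t) * D = 1 - x\<^sup>2" using t by (simp add: D_def algebra_simps)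
  show t0: "0 \<le> t" using D q by (simp add: t_def tpar_def D_def)
  show tl: "t < 1" using t1 D x0 by (smt (verit) zero_less_mult_iff)
  have qx: "x\<^sup>2 * (1 - q x) * (1 - t) = t * (1 - x\<^sup>2)"
    unfolding t[symmetric] t1[symmetric] by simp
  have "envV x * (m * x * (1 - t)) = (1 - x\<^sup>2) * (m * (1 - t)) + x\<^sup>2 * (1 - q x) * (1 - t)"
    using x0 m by (simp add: envV_def field_simps power2_eq_square)
  also have "\<dots> = (1 - x\<^sup>2) * (m * (1 - t) + t)" by (simp only: qx) (simp add: algebra_simps)
  finally have V: "envV x * (m * x * (1 - t)) = (1 - x\<^sup>2) * (m * (1 - t) + t)" .
  then show "envV x = (1 - x\<^sup>2) * (m * (1 - t) + t) / (m * x * (1 - t))"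
    using m x0 tl by (simp add: field_simps)
  define s where "s = m + (1 - m) * t"
  have s: "s > 0" using m t0 by (simp add: s_def add_pos_nonneg)
  have V': "m * envV x = (1 - x\<^sup>2) * s / (x * (1 - t))"
    using V m x0 tl by (simp add: s_def field_simps)
  have "(x * (1 - t))\<^sup>2 * envG2 x = t * (1 - x\<^sup>2)\<^sup>2"
  proof -
    have "(x * (1 - t))\<^sup>2 * envG2 x = (x\<^sup>2 * (1 - q x) * (1 - t)) * ((1 - t) * D)"
      by (simp add: envG2_def D_def power2_eq_square)
    also have "\<dots> = t * (1 - x\<^sup>2) * (1 - x\<^sup>2)" by (simp only: qx t1)
    finally show ?thesis by (simp add: power2_eq_square)
  qed
  then show "ratio x = t / (m + (1 - m) * t)\<^sup>2"
  proof -
    assume *: "(x * (1 - t))\<^sup>2 * envG2 x = t * (1 - x\<^sup>2)\<^sup>2"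
    have "ratio x = (x * (1 - t))\<^sup>2 * envG2 x / ((1 - x\<^sup>2)\<^sup>2 * s\<^sup>2)"
      by (simp add: ratio_def V' power_divide power_mult_distrib)
    also have "\<dots> = t / s\<^sup>2" unfolding * using x0 by simp
    finally show ?thesis by (simp add: s_def)
  qed
qed

lemma t_par_props:
  assumes w: "0 \<le> w" "w \<le> w_max m"
  shows "0 \<le> t_par m w" "t_par m w \<le> m / (1 - m)" "w = t_par m w / (m + (1 - m) * t_par m w)\<^sup>2"
proof -
  define s where "s = sqrt (1 + 4 * m * (m - 1) * w)"
  define d where "d = 1 + 2 * m * (m - 1) * w + s"
  have mm: "4 * m * (1 - m) > 0" using m by simp
  then have le: "4 * m * (1 - m) * w \<le> 1" using w by (simp add: w_max_def field_simps)
  then have s2: "s\<^sup>2 = 1 + 4 * m * (m - 1) * w" and s0: "s \<ge> 0"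
    by (auto simp: s_def algebra_simps)
  have "2 * m * (m - 1) * w = (s\<^sup>2 - 1) / 2" using s2 by simp
  then have d: "d = (1 + s)\<^sup>2 / 2" by (simp add: d_def power2_eq_square field_simps)
  have t: "t_par m w = 4 * m\<^sup>2 * w / (1 + s)\<^sup>2"
  proof -
    have "t_par m w = 2 * m\<^sup>2 * w / d" by (simp add: t_par_def s_def d_def)
    then show ?thesis unfolding d by simp
  qed
  have mw: "4 * m * (1 - m) * w = (1 - s) * (1 + s)" using s2 by (simp add: power2_eq_square algebra_simps)
  then have t': "(1 - m) * t_par m w = m * (1 - s) / (1 + s)"
  proof -
    have "(1 - m) * t_par m w = m * (4 * m * (1 - m) * w) / (1 + s)\<^sup>2"
      by (simp add: t power2_eq_square)
    also have "\<dots> = m * ((1 - s) * (1 + s)) / (1 + s)\<^sup>2" by (simp only: mw)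
    also have "\<dots> = m * (1 - s) / (1 + s)" using s0 by (simp add: power2_eq_square)
    finally show ?thesis .
  qed
  show t0: "0 \<le> t_par m w" using w t by simp
  have "(1 - m) * t_par m w \<le> m" using s0 m unfolding t' by (simp add: divide_le_eq)
  then show "t_par m w \<le> m / (1 - m)" using m by (simp add: field_simps)
  have "m + (1 - m) * t_par m w = 2 * m / (1 + s)" using s0 unfolding t' by (simp add: field_simps)
  then show "w = t_par m w / (m + (1 - m) * t_par m w)\<^sup>2"
    using s0 m by (simp add: t power_divide power_mult_distrib)
qed

lemma ratio_less:
  assumes "p \<le> x" "x < y" "y \<le> cusp"
  shows "ratio x < ratio y"
proof -
  have V: "0 < envV y" "envV y < envV x" using assms p cusp envV_pos[of y] envV_less[of x y] by auto
  have G: "0 \<le> envG2 x" "envG2 x < envG2 y"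
    using assms p cusp envG2_pos[of x] envG2_p envG2_less[of x y] by (cases "x = p"; auto)+
  have "(m * envV y)\<^sup>2 < (m * envV x)\<^sup>2" using V m by (intro power_strict_mono) auto
  then show ?thesis unfolding ratio_def using G V m by (intro frac_less) auto
qed

lemma ratio_cusp: "ratio cusp = w_max m"
proof -
  have max: "(m / (1 - m)) / (m + (1 - m) * (m / (1 - m)))\<^sup>2 = w_max m"
  proof -
    have "m + (1 - m) * (m / (1 - m)) = 2 * m" using m by simp
    then show ?thesis using m by (simp only: w_max_def) (simp add: power2_eq_square)
  qed
  have "\<not> tpar cusp < m / (1 - m)"
  proof
    assume *: "tpar cusp < m / (1 - m)"
    have "m / (1 - m) < 1" using m by (simp add: field_simps)
    moreover have "0 \<le> m / (1 - m)" using m by simp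
    ultimately obtain x where x: "alpha_sol m p (m / (1 - m)) x" "p \<le> x" "x < 1"
      using alpha_sol_unique by metis
    then have t: "tpar x = m / (1 - m)" using alpha_sol_iff by simp
    then have "x \<le> cusp" using tpar_le_iff[OF x(2,3)] by (metis order_refl)
    moreover have "x \<noteq> cusp" using * t by auto
    ultimately have "x < cusp" by simp
    then have "ratio x < ratio cusp" using x by (intro ratio_less) auto
    moreover have "t / (m + (1 - m) * t)\<^sup>2 \<le> 1 / (4 * m * (1 - m))" if "t \<ge> 0" for t
    proof -
      have "4 * m * (1 - m) * t \<le> (m + (1 - m) * t)\<^sup>2"
        using zero_le_power2[of "m - (1 - m) * t"] by (simp add: power2_eq_square algebra_simps)
      moreover have "m + (1 - m) * t > 0" using m that by (simp add: add_pos_nonneg)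
      ultimately show ?thesis using m by (simp add: field_simps)
    qed
    then have "ratio cusp \<le> w_max m"
      using tpar_env(1,3)[of cusp] cusp by (simp add: w_max_def)
    moreover have "ratio x = w_max m" using tpar_env(3)[OF x(2,3)] max by (simp only: t)
    ultimately show False by simp
  qed
  moreover have "tpar cusp \<le> m / (1 - m)" using tpar_le_iff[of cusp] cusp by simp
  ultimately have t: "tpar cusp = m / (1 - m)" by simp
  show ?thesis using tpar_env(3)[of cusp] cusp max by (simp only: t)
qed

lemma alpha_par_props:
  assumes w: "0 \<le> w" "w \<le> w_max m"
  defines "t \<equiv> t_par m w" and "a \<equiv> alpha_par m p (t_par m w)"
  shows "\<exists>!x. alpha_sol m p t x" "p \<le> a" "a \<le> cusp" "ratio a = w"
    "m * a * (1 - t) * X / (p * (1 - a\<^sup>2) * (m * (1 - t) + t)) = X / (p * envV a)"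
proof -
  have "m / (1 - m) < 1" using m by (simp add: field_simps)
  then have t: "0 \<le> t" "t < 1" using t_par_props[OF w] by (auto simp: t_def)
  show ex1: "\<exists>!x. alpha_sol m p t x" by (rule alpha_sol_unique(1)[OF t])
  then have "alpha_sol m p t a" unfolding a_def t_def alpha_par_def by (rule theI')
  then have a: "p \<le> a" "a < 1" "t = tpar a" using alpha_sol_unique(2)[OF t] alpha_sol_iff by auto
  show "p \<le> a" by (rule a)
  show "a \<le> cusp" using t_par_props(2)[OF w] tpar_le_iff[OF a(1,2)] a(3) by (simp add: t_def)
  show "ratio a = w" using t_par_props(3)[OF w] tpar_env(3)[OF a(1,2)] a(3) by (simp add: t_def)
  have "a > 0" "a\<^sup>2 < 1" using a p by (auto simp: power_less_one_iff)
  moreover have "m * (1 - t) + t > 0" using t m by (simp add: add_pos_nonneg)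
  ultimately show "m * a * (1 - t) * X / (p * (1 - a\<^sup>2) * (m * (1 - t) + t)) = X / (p * envV a)"
    using t m p by (simp only: tpar_env(4)[OF a(1,2)] a(3)[symmetric]) (simp add: ac_simps)
qed

definition ball_norm2 :: "real \<Rightarrow> real" where
  "ball_norm2 x = (P * (m * envV x)\<^sup>2 + (1 - P) * envG2 x) / (1 - P)\<^sup>2"

lemma ball_norm2_deriv:
  assumes x: "x > 0"
  shows "(ball_norm2 has_real_derivative
    - 2 * q x * x * slope x * (m * x powr (2 * m - 2) + (1 - m) * x powr (2 * m) - 1) / (1 - P)\<^sup>2) (at x)"
proof -
  define X where "X = x powr (2 * m)"
  have X: "X > 0" using x by (simp add: X_def)
  have qX: "q x = P / X" using q_eq[OF x] by (simp add: X_def)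
  have X2: "x powr (2 * m - 2) = X / x\<^sup>2" using x by (simp add: X_def powr_diff)
  have "(ball_norm2 has_real_derivative (P * (2 * (m * envV x) * (m * (- slope x / m)))
      + (1 - P) * (2 * q x * x * slope x)) / (1 - P)\<^sup>2) (at x)"
    unfolding ball_norm2_def
    by (intro DERIV_cdivide DERIV_add DERIV_cmult envG2_deriv[OF x])
      (auto intro!: derivative_eq_intros envV_deriv[OF x])
  moreover have "P * (2 * (m * envV x) * (m * (- slope x / m))) + (1 - P) * (2 * q x * x * slope x)
    = - 2 * q x * x * slope x * (m * (X / x\<^sup>2) + (1 - m) * X - 1)"
    using x X m by (simp add: envV_def qX field_simps power2_eq_square)
  ultimately show ?thesis by (simp add: X2 X_def)
qed

lemma ball_norm2_factor_pos:
  assumes x: "0 < x" "x < 1"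
  shows "m * x powr (2 * m - 2) + (1 - m) * x powr (2 * m) - 1 > 0"
proof -
  define D where "D = (\<lambda>x. m * x powr (2 * m - 2) + (1 - m) * x powr (2 * m) - 1)"
  have "D 1 < D x"
  proof (rule DERIV_neg_imp_decreasing_open[OF x(2)])
    show "continuous_on {x..1} D" unfolding D_def using x by (intro continuous_intros) auto
    fix y assume y: "x < y" "y < 1"
    then have y0: "y > 0" using x by simp
    have "(D has_real_derivative m * ((2 * m - 2) * y powr (2 * m - 2 - 1))
        + (1 - m) * (2 * m * y powr (2 * m - 1))) (at y)"
      unfolding D_def using y0 by (auto intro!: derivative_eq_intros has_real_derivative_powr)
    moreover have "y powr (2 * m - 1) < y powr (2 * m - 2 - 1)"
      using y y0 by (intro powr_less_mono') auto
    then have "2 * m * (1 - m) * (y powr (2 * m - 1) - y powr (2 * m - 2 - 1)) < 0"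
      using m by (intro mult_pos_neg) auto
    then have "m * ((2 * m - 2) * y powr (2 * m - 2 - 1)) + (1 - m) * (2 * m * y powr (2 * m - 1)) < 0"
      by (simp add: algebra_simps)
    ultimately show "\<exists>d. (D has_real_derivative d) (at y) \<and> d < 0" by blast
  qed
  then show ?thesis by (simp add: D_def)
qed

lemma ball_norm2_cont: "0 < x \<Longrightarrow> continuous_on {x..y} ball_norm2"
  by (intro continuous_at_imp_continuous_on ballI) (auto intro!: DERIV_isCont[OF ball_norm2_deriv])

lemma ball_norm2_decreasing:
  assumes "0 < x" "x < y" "y \<le> cusp"
  shows "ball_norm2 y < ball_norm2 x"
proof (rule DERIV_neg_imp_decreasing_open[of x y ball_norm2])
  fix z assume "x < z" "z < y"
  then have z: "0 < z" "z < 1" "slope z > 0" using assms slope_pos_iff[of z] cusp by auto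
  have "0 < 2 * q z * z * slope z * (m * z powr (2 * m - 2) + (1 - m) * z powr (2 * m) - 1) / (1 - P)\<^sup>2"
    using z ball_norm2_factor_pos[OF z(1,2)] q_pos P_bounds by (intro divide_pos_pos mult_pos_pos) auto
  then show "\<exists>d. (ball_norm2 has_real_derivative d) (at z) \<and> d < 0"
    using ball_norm2_deriv[OF z(1)] by (intro exI conjI) auto
qed (use assms ball_norm2_cont in auto)

lemma ball_norm2_increasing:
  assumes "cusp \<le> x" "x < y" "y \<le> 1"
  shows "ball_norm2 x < ball_norm2 y"
proof (rule DERIV_pos_imp_increasing_open[of x y ball_norm2])
  have x0: "x > 0" using assms cusp p by simp
  then show "continuous_on {x..y} ball_norm2" by (rule ball_norm2_cont)
  fix z assume "x < z" "z < y"
  then have z: "0 < z" "z < 1" "slope z < 0" using assms x0 slope_neg_iff[of z] by auto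
  have "0 < 2 * q z * z * (- slope z) * (m * z powr (2 * m - 2) + (1 - m) * z powr (2 * m) - 1) / (1 - P)\<^sup>2"
    using z ball_norm2_factor_pos[OF z(1,2)] q_pos P_bounds by (intro divide_pos_pos mult_pos_pos) auto
  then show "\<exists>d. (ball_norm2 has_real_derivative d) (at z) \<and> d > 0"
    using ball_norm2_deriv[OF z(1)] by (intro exI conjI) auto
qed (use assms in auto)

lemma ball_norm2_1: "ball_norm2 1 = 1"
proof -
  have "ball_norm2 1 = (P * (1 - P)\<^sup>2 + (1 - P) * (1 - P)\<^sup>2) / (1 - P)\<^sup>2"
    using m by (simp add: ball_norm2_def envV_1 envG2_1)
  also have "P * (1 - P)\<^sup>2 + (1 - P) * (1 - P)\<^sup>2 = (1 - P)\<^sup>2"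
    by (simp add: algebra_simps)
  finally show ?thesis using P_bounds by simp
qed

lemma ball_norm2_less_1: "cusp \<le> x \<Longrightarrow> x < 1 \<Longrightarrow> ball_norm2 x < 1"
  using ball_norm2_increasing[of x 1] ball_norm2_1 by simp

lemma x0_sol_iff: "x0_sol m p x \<longleftrightarrow> 0 < x \<and> x < 1 \<and> ball_norm2 x = 1"
proof (cases "0 < x \<and> x < 1")
  case True
  then have x: "x > 0" by simp
  define X where "X = x powr (2 * m)"
  have X: "X > 0" using x by (simp add: X_def)
  have qX: "q x = P / X" using q_eq[OF x] by (simp add: X_def)
  have X2: "x powr (2 * m - 2) = X / x\<^sup>2" using x by (simp add: X_def powr_diff)
  have XX: "x powr (4 * m) = X * X" by (simp add: X_def powr_add[symmetric])
  have X42: "x powr (4 * m - 2) = X * X / x\<^sup>2" using x by (simp add: powr_diff XX)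
  have X44: "x powr (4 * m - 4) = X * X / x ^ 4" using x by (simp add: powr_diff XX)
  define E where "E = - (1 - m)\<^sup>2 * (X * X) + (- 1 - 2 * m + 2 * m\<^sup>2 + P) * (X * X / x\<^sup>2)
     - m\<^sup>2 * (X * X / x ^ 4) + (1 - (2 * m - 1) * P) * X + (1 + (2 * m - 1) * P) * (X / x\<^sup>2) - P"
  have "x0_sol m p x \<longleftrightarrow> E = 0"
    using True by (simp add: x0_sol_def E_def XX X42 X44 X2 X_def P_def)
  moreover have "P * (m * envV x)\<^sup>2 + (1 - P) * envG2 x - (1 - P)\<^sup>2 = - (P * x\<^sup>2 / X\<^sup>2) * E"
  proof -
    have mV: "m * envV x = (m * (1 - x\<^sup>2) * X + x\<^sup>2 * (X - P)) / (x * X)"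
      using x X m by (simp add: envV_def qX field_simps power2_eq_square)
    have G2: "envG2 x = (X - P) * (X - x\<^sup>2 * P) / X\<^sup>2"
      using X by (simp add: envG2_def qX field_simps power2_eq_square)
    have Ex: "E * x ^ 4 = - (1 - m)\<^sup>2 * (X * X) * (x\<^sup>2)\<^sup>2 + (- 1 - 2 * m + 2 * m\<^sup>2 + P) * (X * X) * x\<^sup>2
     - m\<^sup>2 * (X * X) + (1 - (2 * m - 1) * P) * X * (x\<^sup>2)\<^sup>2 + (1 + (2 * m - 1) * P) * X * x\<^sup>2 - P * (x\<^sup>2)\<^sup>2"
    proof -
      have "(a * b / x\<^sup>2) * x ^ 4 = a * b * x\<^sup>2" "a * (b / x\<^sup>2) * x ^ 4 = a * b * x\<^sup>2"
        "a * (b / x ^ 4) * x ^ 4 = a * b" "x ^ 4 = (x\<^sup>2)\<^sup>2" for a b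
        using x by (auto simp: field_simps power2_eq_square power4_eq_xxxx)
      then show ?thesis unfolding E_def by (simp only: distrib_right left_diff_distrib)
    qed
    have "(P * (m * envV x)\<^sup>2 + (1 - P) * envG2 x - (1 - P)\<^sup>2) * (x\<^sup>2 * X\<^sup>2)
       = P * (m * (1 - x\<^sup>2) * X + x\<^sup>2 * (X - P))\<^sup>2 + (1 - P) * x\<^sup>2 * ((X - P) * (X - x\<^sup>2 * P)) - (1 - P)\<^sup>2 * x\<^sup>2 * X\<^sup>2"
    proof -
      have "(P * (u / (x * X))\<^sup>2 + (1 - P) * (g / X\<^sup>2) - s) * (x\<^sup>2 * X\<^sup>2)
          = P * u\<^sup>2 + (1 - P) * x\<^sup>2 * g - s * x\<^sup>2 * X\<^sup>2" for u g s
        using x X by (simp add: power_divide power_mult_distrib field_simps)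
      then show ?thesis unfolding mV G2 .
    qed
    also have "\<dots> = - P * (E * x ^ 4)"
      unfolding Ex by (simp add: algebra_simps power2_eq_square)
    also have "\<dots> = - (P * x\<^sup>2 / X\<^sup>2) * E * (x\<^sup>2 * X\<^sup>2)"
      using X by (simp add: power4_eq_xxxx power2_eq_square)
    finally show ?thesis using x X by (subst (asm) mult_cancel_right) auto
  qed
  ultimately show ?thesis
    using True X P_bounds x by (auto simp: ball_norm2_def divide_eq_1_iff)
qed (auto simp: x0_sol_def)

lemma switch_exists:
  "\<exists>x. p < x \<and> x < cusp \<and> ball_norm2 x = 1 \<and> 1 < ratio x"
proof -
  have cusp0: "cusp > 0" using cusp p by simp
  have "\<exists>x\<ge>p. x \<le> cusp \<and> envG2 x = (1 - P)\<^sup>2"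
  proof (rule IVT')
    show "(1 - P)\<^sup>2 \<le> envG2 cusp" using envG2_le_cusp[of 1] by (simp add: envG2_1)
  qed (use cusp p in \<open>auto simp: envG2_p intro: envG2_cont_on\<close>)
  then obtain a where a: "p \<le> a" "a \<le> cusp" "envG2 a = (1 - P)\<^sup>2" by blast
  have a0: "a > 0" using a p by simp
  \<comment> \<open>With this \<open>\<kappa>\<close> the two factors of the derivative of \<open>envV + \<kappa> * envG2\<close> both change sign at the cusp.\<close>
  define \<kappa> where "\<kappa> = 1 / (2 * m * (q cusp * cusp))"
  have "envV 1 + \<kappa> * envG2 1 < envV a + \<kappa> * envG2 a"
  proof -
    define J where "J = (\<lambda>x. envV x + \<kappa> * envG2 x)"
    have dJ: "(J has_real_derivative slope x * (2 * \<kappa> * (q x * x) - 1 / m)) (at x)" if "x > 0" for x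
    proof -
      have "(J has_real_derivative - slope x / m + \<kappa> * (2 * q x * x * slope x)) (at x)"
        unfolding J_def by (intro DERIV_add DERIV_cmult envV_deriv envG2_deriv that)
      then show ?thesis by (simp add: algebra_simps)
    qed
    have qx: "q x * x = P * x powr (1 - 2 * m)" if "x > 0" for x
      using that by (simp add: q_eq powr_diff)
    have qx_less: "q x * x < q y * y" if "0 < x" "x < y" for x y
      using that m P_bounds by (simp add: qx powr_less_mono2)
    have \<kappa>: "2 * \<kappa> * (q cusp * cusp) = 1 / m" and \<kappa>0: "\<kappa> > 0"
      using cusp0 q_pos[OF cusp0] m by (auto simp: \<kappa>_def)
    have neg: "slope x * (2 * \<kappa> * (q x * x) - 1 / m) < 0" if x: "x > 0" "x \<noteq> cusp" for x
    proof (cases "x < cusp")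
      case True
      have "2 * \<kappa> * (q x * x) < 2 * \<kappa> * (q cusp * cusp)"
        using qx_less[OF x(1) True] \<kappa>0 by (intro mult_strict_left_mono) auto
      then show ?thesis using slope_pos_iff[OF x(1)] True \<kappa> by (intro mult_pos_neg) auto
    next
      case False
      have "2 * \<kappa> * (q cusp * cusp) < 2 * \<kappa> * (q x * x)"
        using qx_less[OF cusp0, of x] False x(2) \<kappa>0 by (intro mult_strict_left_mono) auto
      then show ?thesis using slope_neg_iff[OF x(1)] False x(2) \<kappa> by (intro mult_neg_pos) auto
    qed
    have contJ: "continuous_on {x..y} J" if "x > 0" for x y
      using that by (intro continuous_at_imp_continuous_on ballI) (auto intro!: DERIV_isCont[OF dJ])
    have "J cusp \<le> J a"
    proof (rule DERIV_nonpos_imp_decreasing_open[OF a(2) _ contJ[OF a0]])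
      show "\<exists>d. (J has_real_derivative d) (at x) \<and> d \<le> 0" if "a < x" "x < cusp" for x
        using dJ[of x] neg[of x] that a0 by (intro exI conjI) auto
    qed
    moreover have "J 1 < J cusp"
    proof (rule DERIV_neg_imp_decreasing_open[OF cusp(2) _ contJ[OF cusp0]])
      show "\<exists>d. (J has_real_derivative d) (at x) \<and> d < 0" if "cusp < x" "x < 1" for x
        using dJ[of x] neg[of x] that cusp0 by (intro exI conjI) auto
    qed
    ultimately show ?thesis by (simp add: J_def)
  qed
  then have Va: "(1 - P) / m < envV a" by (simp add: a(3) envG2_1 envV_1)
  have ratio_a: "ratio a < 1"
  proof -
    have "1 - P < m * envV a" using Va m by (simp add: field_simps)
    then have "(1 - P)\<^sup>2 < (m * envV a)\<^sup>2" using P_bounds by (intro power_strict_mono) auto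
    then show ?thesis using zero_le_power2[of "1 - P"] unfolding ratio_def a(3)
      by (subst divide_less_eq_1_pos) linarith+
  qed
  have norm_eq: "ball_norm2 x = envG2 x * (P + (1 - P)) / (1 - P)\<^sup>2"
    if "ratio x = 1" "p \<le> x" "x \<le> 1" for x
  proof -
    have "(m * envV x)\<^sup>2 = envG2 x" using that(1) by (auto simp: ratio_def divide_eq_1_iff)
    then show ?thesis by (simp add: ball_norm2_def algebra_simps)
  qed
  have "1 < ratio cusp"
  proof -
    have "4 * m * (1 - m) < 1" using zero_less_power2[of "1 - 2 * m"] m
      by (simp add: power2_eq_square algebra_simps)
    then show ?thesis using m by (simp add: ratio_cusp w_max_def field_simps)
  qed
  have "\<exists>b\<ge>a. b \<le> cusp \<and> ratio b = 1"
  proof (rule IVT')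
    show "continuous_on {a..cusp} ratio" unfolding ratio_def
    proof (intro continuous_intros envG2_cont_on a0)
      show "continuous_on {a..cusp} envV"
        unfolding envV_def using a0 m by (intro continuous_intros q_cont_on) auto
      show "\<forall>x\<in>{a..cusp}. (m * envV x)\<^sup>2 \<noteq> 0"
      proof
        fix x assume "x \<in> {a..cusp}"
        then have "envV x > 0" using a cusp by (intro envV_pos) auto
        then show "(m * envV x)\<^sup>2 \<noteq> 0" using m by simp
      qed
    qed
  qed (use ratio_a \<open>1 < ratio cusp\<close> a in auto)
  then obtain b where b: "a \<le> b" "b \<le> cusp" "ratio b = 1" by blast
  have "b \<noteq> a" using b ratio_a by auto
  then have "envG2 a < envG2 b" using b a0 by (intro envG2_less) auto
  then have "ball_norm2 b > 1"
    using norm_eq[OF b(3)] a b cusp P_bounds by simp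
  have "\<exists>x\<ge>b. x \<le> cusp \<and> ball_norm2 x = 1"
    by (rule IVT2') (use \<open>ball_norm2 b > 1\<close> b a0 ball_norm2_less_1[of cusp] cusp in \<open>auto intro: ball_norm2_cont\<close>)
  then obtain x where x: "b \<le> x" "x \<le> cusp" "ball_norm2 x = 1" by blast
  have "x \<noteq> b" "x \<noteq> cusp" using x \<open>ball_norm2 b > 1\<close> ball_norm2_less_1[of cusp] cusp by auto
  then have "p < x" "x < cusp" "b < x" using x a b by auto
  moreover have "ratio b < ratio x" using calculation a b by (intro ratio_less) auto
  ultimately show ?thesis using x b(3) by auto
qed

section \<open>The Kobayashi metric\<close>

lemma w_max_gt_1: "w_max m > 1"
proof -
  obtain x where "p < x" "x < cusp" "1 < ratio x" using switch_exists by blast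
  then show ?thesis using ratio_less[of x cusp] by (simp add: ratio_cusp)
qed

definition ball_metric :: "real \<Rightarrow> real \<Rightarrow> real" where
  "ball_metric X Y = sqrt (P * (m * X)\<^sup>2 + (1 - P) * Y\<^sup>2) / (1 - P)"

lemma ball_metric_scale: "ball_metric (s * X) (s * Y) = \<bar>s\<bar> * ball_metric X Y"
proof -
  have "P * (m * (s * X))\<^sup>2 + (1 - P) * (s * Y)\<^sup>2 = s\<^sup>2 * (P * (m * X)\<^sup>2 + (1 - P) * Y\<^sup>2)"
    by (simp add: power2_eq_square algebra_simps)
  then show ?thesis by (simp only: ball_metric_def real_sqrt_mult real_sqrt_abs) simp
qed

lemma ball_metric_le_1_iff:
  "ball_metric X Y \<le> 1 \<longleftrightarrow> P * (m * X)\<^sup>2 + (1 - P) * Y\<^sup>2 \<le> (1 - P)\<^sup>2"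
  using P_bounds real_sqrt_le_iff[of "P * (m * X)\<^sup>2 + (1 - P) * Y\<^sup>2" "(1 - P)\<^sup>2"]
  by (simp add: ball_metric_def divide_le_eq)

lemma ball_metric_env: "p \<le> x \<Longrightarrow> x \<le> 1 \<Longrightarrow> ball_metric (envV x) (sqrt (envG2 x)) = sqrt (ball_norm2 x)"
  using P_bounds envG2_pos[of x] envG2_p
  by (cases "x = p") (auto simp: ball_metric_def ball_norm2_def real_sqrt_divide)

lemma ratio_scale:
  assumes "p \<le> a" "a \<le> cusp" "X > 0" "Y \<ge> 0" "ratio a = Y\<^sup>2 / (m\<^sup>2 * X\<^sup>2)"
  shows "Y = X / envV a * sqrt (envG2 a)"
proof -
  have a: "a \<le> 1" using assms cusp by simp
  have V: "envV a > 0" using assms envV_pos a by simp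
  have G: "envG2 a \<ge> 0" using envG2_pos[of a] envG2_p assms a by (cases "a = p") auto
  have "Y\<^sup>2 = (X / envV a)\<^sup>2 * envG2 a"
    using assms(5,3) V m by (simp add: ratio_def field_simps)
  also have "\<dots> = (X / envV a * sqrt (envG2 a))\<^sup>2" using G by (simp only: power_mult_distrib real_sqrt_pow2)
  finally show ?thesis using assms V G by (simp add: power2_eq_iff_nonneg)
qed

lemma ball_metric_envelope:
  assumes "p \<le> a" "a \<le> cusp" "X > 0" "Y \<ge> 0" "ratio a = Y\<^sup>2 / (m\<^sup>2 * X\<^sup>2)"
  shows "ball_metric X Y = X / envV a * sqrt (ball_norm2 a)"
proof -
  have a: "a \<le> 1" using assms cusp by simp
  have V: "envV a > 0" using assms envV_pos a by simp
  have "ball_metric (X / envV a * envV a) (X / envV a * sqrt (envG2 a)) = X / envV a * sqrt (ball_norm2 a)"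
    using assms V by (simp only: ball_metric_scale ball_metric_env[OF assms(1) a]) simp
  then show ?thesis using ratio_scale[OF assms] V by simp
qed

lemma lower_bound_envelope:
  assumes a: "p \<le> a" "a \<le> cusp" and XY: "X > 0" "Y > 0" and r: "ratio a = Y\<^sup>2 / (m\<^sup>2 * X\<^sup>2)"
    and b: "p < b" "b \<le> cusp" "envG2 b = (Y / \<mu>)\<^sup>2" "X / \<mu> \<le> envV b" and \<mu>: "\<mu> > 0"
  shows "X / envV a \<le> \<mu>"
proof -
  have "ratio b \<le> ratio a"
  proof -
    have X\<mu>: "0 < m * (X / \<mu>)" using XY \<mu> m by simp
    then have le: "(m * (X / \<mu>))\<^sup>2 \<le> (m * envV b)\<^sup>2"
      using b m by (intro power_mono mult_left_mono) auto
    have "(m * (X / \<mu>))\<^sup>2 > 0" using X\<mu> by (rule zero_less_power)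
    then have pos: "(m * envV b)\<^sup>2 * (m * (X / \<mu>))\<^sup>2 > 0" using le by (intro mult_pos_pos) linarith+
    have "ratio b \<le> (Y / \<mu>)\<^sup>2 / (m * (X / \<mu>))\<^sup>2"
      unfolding ratio_def b(3) by (rule divide_left_mono[OF le zero_le_power2 pos])
    also have "\<dots> = ratio a" using XY \<mu> by (simp add: r power_divide power_mult_distrib)
    finally show ?thesis .
  qed
  then have "b \<le> a" using ratio_less[of a b] a b by (cases "b \<le> a") auto
  then have "(Y / \<mu>)\<^sup>2 \<le> envG2 a" using b p a by (metis envG2_mono less_trans)
  then have "Y / \<mu> \<le> sqrt (envG2 a)" by (rule real_le_rsqrt)
  moreover have V: "envV a > 0" using envV_pos a cusp by simp
  have "sqrt (envG2 a) = Y / (X / envV a)" using ratio_scale[OF a XY(1) _ r] XY V by simp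
  ultimately have "Y / \<mu> \<le> Y / (X / envV a)" by simp
  then show ?thesis using XY \<mu> V by (simp add: field_simps)
qed

lemma lower_bound_ball_envelope:
  assumes XY: "X \<ge> 0" "Y > 0" and w: "w_max m * (m\<^sup>2 * X\<^sup>2) \<le> Y\<^sup>2"
    and b: "p < b" "b \<le> cusp" "envG2 b = (Y / \<mu>)\<^sup>2" and \<mu>: "\<mu> > 0"
  shows "ball_metric X Y \<le> \<mu>"
proof -
  have wm: "w_max m > 0" using m by (simp add: w_max_def)
  have b0: "b > 0" using b p by simp
  have V: "envV cusp > 0" using envV_pos cusp by simp
  have "w_max m * (m * (X / \<mu>))\<^sup>2 \<le> (Y / \<mu>)\<^sup>2"
    using divide_right_mono[OF w, of "\<mu>\<^sup>2"] by (simp add: power_divide power_mult_distrib)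
  also have G: "(Y / \<mu>)\<^sup>2 \<le> envG2 cusp" using envG2_le_cusp[OF b0] b(3) by simp
  also have "envG2 cusp = w_max m * (m * envV cusp)\<^sup>2"
    using ratio_cusp V m by (simp add: ratio_def field_simps)
  finally have "(m * (X / \<mu>))\<^sup>2 \<le> (m * envV cusp)\<^sup>2" using wm by simp
  then have "P * (m * (X / \<mu>))\<^sup>2 + (1 - P) * (Y / \<mu>)\<^sup>2 \<le> P * (m * envV cusp)\<^sup>2 + (1 - P) * envG2 cusp"
    using G P_bounds by (intro add_mono mult_left_mono) auto
  also have "\<dots> \<le> (1 - P)\<^sup>2"
    using ball_norm2_less_1[of cusp] cusp P_bounds by (simp add: ball_norm2_def divide_less_eq)
  finally have "ball_metric (1 / \<mu> * X) (1 / \<mu> * Y) \<le> 1" by (simp add: ball_metric_le_1_iff)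
  then show ?thesis using \<mu> by (simp only: ball_metric_scale) (simp add: divide_le_eq)
qed

lemma lower_bound_ball:
  assumes b: "1 - P < Y / \<mu>" "P * (m * (X / \<mu>))\<^sup>2 + (1 - P) * (Y / \<mu>)\<^sup>2 \<le> (1 - P)\<^sup>2" and \<mu>: "\<mu> > 0"
  shows "ball_metric X Y \<le> \<mu>" "m\<^sup>2 * X\<^sup>2 < Y\<^sup>2"
proof -
  have "ball_metric (1 / \<mu> * X) (1 / \<mu> * Y) \<le> 1" using b by (simp add: ball_metric_le_1_iff)
  then show "ball_metric X Y \<le> \<mu>" using \<mu> by (simp only: ball_metric_scale) (simp add: divide_le_eq)
  have "(1 - P)\<^sup>2 < (Y / \<mu>)\<^sup>2" using b(1) P_bounds by (intro power_strict_mono) auto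
  then have "P * (m * (X / \<mu>))\<^sup>2 < P * (Y / \<mu>)\<^sup>2" using b(2) by (simp add: algebra_simps)
  then have "(m * (X / \<mu>))\<^sup>2 < (Y / \<mu>)\<^sup>2" using P_bounds by simp
  then show "m\<^sup>2 * X\<^sup>2 < Y\<^sup>2" using \<mu> by (simp add: power_divide power_mult_distrib divide_less_cancel)
qed

text \<open>\<open>b = c\<close> gives the discs of the envelope, and \<open>b = 1\<close>, where the Blaschke factor is constant, those of the ball.\<close>

lemma ellipsoid_disc:
  fixes k :: "'n::finite" and v :: "complex ^ 'n"
  assumes b: "p \<le> b" "b \<le> 1" and c: "0 \<le> c" "c \<le> 1"
    and l: "l \<noteq> 0" "v $ k = - l * of_real (p * ((1 - b\<^sup>2) / b + c * (1 - q b) / m))"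
      "(\<Sum>i\<in>UNIV - {k}. (cmod (v $ i))\<^sup>2) = (cmod l)\<^sup>2 * ((1 - q b) * (1 - c\<^sup>2 * q b))"
  shows "l \<in> kobayashi_competitors (ellipsoid k m) (axis k (of_real p)) v"
proof -
  define q0 where "q0 = q b"
  have b0: "b > 0" using b p by simp
  have q0: "0 < q0" "q0 \<le> 1" using b q_pos[OF b0] q_le_1 by (auto simp: q0_def)
  have cq: "0 \<le> c * q0" "c * q0 \<le> 1" using q0 c mult_le_one[of c q0] by auto
  define N where "N = (\<lambda>\<zeta>::complex. 1 - of_real c * \<zeta>)"
  define D where "D = (\<lambda>\<zeta>::complex. 1 - of_real (c * q0) * \<zeta>)"
  define B where "B = (\<lambda>\<zeta>::complex. (of_real b - \<zeta>) / (1 - of_real b * \<zeta>))"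
  define h where "h = (\<lambda>\<zeta>. exp ((Ln (N \<zeta>) - Ln (D \<zeta>)) / of_real m))"
  define f where "f = (\<lambda>\<zeta>. \<chi> i. if i = k then of_real (p / b) * B \<zeta> * h \<zeta> else \<zeta> / D \<zeta> * (v $ i / l))"
  have re: "Re (N \<zeta>) > 0" "Re (D \<zeta>) > 0" "Re (1 - of_real b * \<zeta>) > 0" if "\<zeta> \<in> ball 0 1" for \<zeta>
    using one_minus_unit_mult[of c \<zeta>] one_minus_unit_mult[of "c * q0" \<zeta>] one_minus_unit_mult[of b \<zeta>]
      that c cq b b0 unfolding N_def D_def by auto
  have nr: "N \<zeta> \<notin> \<real>\<^sub>\<le>\<^sub>0" "D \<zeta> \<notin> \<real>\<^sub>\<le>\<^sub>0" if "\<zeta> \<in> ball 0 1" for \<zeta>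
    using re[OF that] by (auto simp: complex_nonpos_Reals_iff)
  have nz: "N \<zeta> \<noteq> 0" "D \<zeta> \<noteq> 0" "1 - of_real b * \<zeta> \<noteq> 0" if "\<zeta> \<in> ball 0 1" for \<zeta>
    using re[OF that] by fastforce+
  have holND: "N holomorphic_on S" "D holomorphic_on S" for S
    unfolding N_def D_def by (intro holomorphic_intros)+
  have comp: "(\<lambda>\<zeta>. f \<zeta> $ i) holomorphic_on ball 0 1" for i
  proof (cases "i = k")
    case True
    have "(\<lambda>\<zeta>. of_real (p / b) * B \<zeta> * h \<zeta>) holomorphic_on ball 0 1"
      unfolding B_def h_def using nz nr m by (intro holomorphic_intros holND) auto
    then show ?thesis by (simp add: f_def True)
  next
    case False
    have "(\<lambda>\<zeta>. \<zeta> / D \<zeta> * (v $ i / l)) holomorphic_on ball 0 1"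
      using nz l by (intro holomorphic_intros holND) auto
    then show ?thesis by (simp add: f_def False)
  qed
  have mem: "f \<zeta> \<in> ellipsoid k m" if z: "\<zeta> \<in> ball 0 1" for \<zeta>
  proof -
    have z2: "(cmod \<zeta>)\<^sup>2 < 1" using z by (simp add: abs_square_less_1)
    have h: "cmod (h \<zeta>) powr (2 * m) = (cmod (N \<zeta>))\<^sup>2 / (cmod (D \<zeta>))\<^sup>2"
    proof -
      have "cmod (h \<zeta>) powr (2 * m) = exp (2 * (ln (cmod (N \<zeta>)) - ln (cmod (D \<zeta>))))"
        using m nz[OF z] by (simp add: h_def powr_def Re_Ln Re_divide_of_real)
      also have "\<dots> = (exp (ln (cmod (N \<zeta>))) / exp (ln (cmod (D \<zeta>))))\<^sup>2"
        by (simp only: exp_double exp_diff)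
      finally show ?thesis using nz[OF z] by (simp add: power_divide)
    qed
    have fk: "cmod (f \<zeta> $ k) powr (2 * m) = cmod (B \<zeta>) powr (2 * m) * (q0 * (cmod (N \<zeta>))\<^sup>2 / (cmod (D \<zeta>))\<^sup>2)"
    proof -
      have "cmod (f \<zeta> $ k) = p / b * cmod (B \<zeta>) * cmod (h \<zeta>)"
        using p b0 by (simp add: f_def norm_mult norm_divide)
      moreover have "(p / b * cmod (B \<zeta>) * cmod (h \<zeta>)) powr (2 * m)
          = (p / b) powr (2 * m) * cmod (B \<zeta>) powr (2 * m) * cmod (h \<zeta>) powr (2 * m)"
        using p b0 by (simp only: powr_mult)
      ultimately show ?thesis by (simp only: h q0_def q_def) simp
    qed
    have sm: "(\<Sum>i\<in>UNIV - {k}. (cmod (f \<zeta> $ i))\<^sup>2) = (1 - q0) * (1 - c\<^sup>2 * q0) * (cmod \<zeta>)\<^sup>2 / (cmod (D \<zeta>))\<^sup>2"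
    proof -
      have "(\<Sum>i\<in>UNIV - {k}. (cmod (f \<zeta> $ i))\<^sup>2)
        = (\<Sum>i\<in>UNIV - {k}. (cmod (v $ i))\<^sup>2 * ((cmod \<zeta>)\<^sup>2 / (cmod (D \<zeta>))\<^sup>2 / (cmod l)\<^sup>2))"
        by (intro sum.cong refl) (simp add: f_def norm_mult norm_divide power_mult_distrib power_divide)
      also have "\<dots> = (1 - q0) * (1 - c\<^sup>2 * q0) * (cmod \<zeta>)\<^sup>2 / (cmod (D \<zeta>))\<^sup>2"
        using l(1) by (simp only: sum_distrib_right[symmetric] l(3) q0_def) simp
      finally show ?thesis .
    qed
    have id: "q0 * (cmod (N \<zeta>))\<^sup>2 + (1 - q0) * (1 - c\<^sup>2 * q0) * (cmod \<zeta>)\<^sup>2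
        = (cmod (D \<zeta>))\<^sup>2 - (1 - q0) * (1 - (cmod \<zeta>)\<^sup>2)"
      using cmod2_geodesic_identity[of c q0 \<zeta>] by (simp add: N_def D_def)
    have B2: "(cmod (1 - of_real b * \<zeta>))\<^sup>2 - (cmod (\<zeta> - of_real b))\<^sup>2 = (1 - b\<^sup>2) * (1 - (cmod \<zeta>)\<^sup>2)"
      using cmod2_moebius[of "of_real b" \<zeta>] by simp
    have B: "cmod (B \<zeta>) = cmod (\<zeta> - of_real b) / cmod (1 - of_real b * \<zeta>)"
      by (simp add: B_def norm_divide norm_minus_commute)
    have "cmod (B \<zeta>) powr (2 * m) * (q0 * (cmod (N \<zeta>))\<^sup>2) + (1 - q0) * (1 - c\<^sup>2 * q0) * (cmod \<zeta>)\<^sup>2 < (cmod (D \<zeta>))\<^sup>2"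
    proof (cases "b = 1")
      case True
      then have "cmod (B \<zeta>) = 1" using nz[OF z] by (simp add: B_def)
      moreover have "q0 < 1" using True p m q_less_1[of 1] by (simp add: q0_def)
      then have "(1 - q0) * (1 - (cmod \<zeta>)\<^sup>2) > 0" using z2 by simp
      ultimately show ?thesis using id by simp
    next
      case False
      then have "b\<^sup>2 < 1" using b b0 by (simp add: power_less_one_iff)
      then have "(1 - b\<^sup>2) * (1 - (cmod \<zeta>)\<^sup>2) > 0" using z2 by simp
      then have "(cmod (\<zeta> - of_real b))\<^sup>2 < (cmod (1 - of_real b * \<zeta>))\<^sup>2" using B2 by linarith
      then have "cmod (\<zeta> - of_real b) < cmod (1 - of_real b * \<zeta>)" by (rule power2_less_imp_less) simp
      then have "cmod (B \<zeta>) < 1" using nz[OF z] unfolding B by simp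
      then have "cmod (B \<zeta>) powr (2 * m) < 1"
        using m powr_less_mono2[of "2 * m" "cmod (B \<zeta>)" 1] by simp
      moreover have "q0 * (cmod (N \<zeta>))\<^sup>2 > 0" using q0 nz[OF z] by simp
      ultimately have "cmod (B \<zeta>) powr (2 * m) * (q0 * (cmod (N \<zeta>))\<^sup>2) < 1 * (q0 * (cmod (N \<zeta>))\<^sup>2)"
        by (intro mult_strict_right_mono)
      moreover have "(1 - q0) * (1 - (cmod \<zeta>)\<^sup>2) \<ge> 0" using z2 q0 by simp
      ultimately show ?thesis using id by linarith
    qed
    then show ?thesis using nz[OF z]
      by (simp add: ellipsoid_def fk sm add_divide_distrib[symmetric] divide_less_eq)
  qed
  have f0: "f 0 = axis k (of_real p)"
    using b0 by (simp add: vec_eq_iff f_def axis_def B_def h_def N_def D_def)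
  have DL: "((\<lambda>\<zeta>. Ln (1 - of_real a * \<zeta>)) has_field_derivative - of_real a) (at 0)" for a :: real
    by (auto intro!: derivative_eq_intros)
  have "((\<lambda>\<zeta>. of_real (p / b) * B \<zeta> * h \<zeta>) has_field_derivative
     - of_real (p * ((1 - b\<^sup>2) / b + c * (1 - q b) / m))) (at 0)"
  proof -
    have dB: "(B has_field_derivative - of_real (1 - b\<^sup>2)) (at 0)"
      unfolding B_def by (auto intro!: derivative_eq_intros simp: power2_eq_square)
    have "((\<lambda>\<zeta>. (Ln (N \<zeta>) - Ln (D \<zeta>)) / of_real m) has_field_derivative
        (- of_real c - - of_real (c * q0)) / of_real m) (at 0)"
      unfolding N_def D_def by (intro DERIV_cdivide DERIV_diff DL)
    then have "(h has_field_derivative exp ((Ln (N 0) - Ln (D 0)) / of_real m) *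
        ((- of_real c - - of_real (c * q0)) / of_real m)) (at 0)"
      unfolding h_def by (rule DERIV_chain2[OF DERIV_exp])
    then have dh: "(h has_field_derivative - of_real (c * (1 - q0) / m)) (at 0)"
      by (simp add: N_def D_def algebra_simps diff_divide_distrib)
    have h0: "h 0 = 1" and B0: "B 0 = of_real b" by (auto simp: h_def N_def D_def B_def)
    have "((\<lambda>\<zeta>. of_real (p / b) * (B \<zeta> * h \<zeta>)) has_field_derivative
       of_real (p / b) * (B 0 * (- of_real (c * (1 - q0) / m)) + (- of_real (1 - b\<^sup>2)) * h 0)) (at 0)"
      by (intro DERIV_cmult DERIV_mult' dB dh)
    moreover have "of_real (p / b) * (B 0 * (- of_real (c * (1 - q0) / m)) + (- of_real (1 - b\<^sup>2)) * h 0)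
       = - complex_of_real (p * ((1 - b\<^sup>2) / b + c * (1 - q b) / m))"
    proof -
      have "p / b * (b * (- (c * (1 - q0) / m)) + (- (1 - b\<^sup>2))) = - (p * ((1 - b\<^sup>2) / b + c * (1 - q b) / m))"
        using b0 m by (simp add: q0_def field_simps)
      then show ?thesis unfolding h0 B0
        by (simp only: of_real_mult[symmetric] of_real_minus[symmetric] of_real_add[symmetric] mult_1_right)
    qed
    ultimately show ?thesis by (simp add: mult.assoc)
  qed
  then have "deriv (\<lambda>\<zeta>. f \<zeta> $ k) 0 = v $ k / l"
    using l by (simp add: f_def DERIV_imp_deriv)
  moreover have "deriv (\<lambda>\<zeta>. f \<zeta> $ i) 0 = v $ i / l" if "i \<noteq> k" for i
  proof -
    have "((\<lambda>\<zeta>. \<zeta> / D \<zeta> * (v $ i / l)) has_field_derivative v $ i / l) (at 0)"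
      unfolding D_def by (auto intro!: derivative_eq_intros simp: l(1))
    then show ?thesis using that by (simp add: f_def DERIV_imp_deriv)
  qed
  ultimately have "disc_deriv f 0 $ i = v $ i / l" for i
    by (cases "i = k") (auto simp: disc_deriv_def)
  then have "l *s disc_deriv f 0 = v" using l(1) by (simp add: vec_eq_iff)
  then show ?thesis using f0 mem comp
    by (auto simp: kobayashi_competitors_def holomorphic_disc_def intro!: exI[of _ f])
qed

lemma ellipsoid_disc_real:
  fixes k :: "'n::finite" and v :: "complex ^ 'n"
  assumes b: "p \<le> b" "b \<le> 1" and c: "0 \<le> c" "c \<le> 1" and \<mu>: "\<mu> > 0"
    and X: "cmod (v $ k) / p = \<mu> * ((1 - b\<^sup>2) / b + c * (1 - q b) / m)"
    and Y: "(\<Sum>i\<in>UNIV - {k}. (cmod (v $ i))\<^sup>2) = \<mu>\<^sup>2 * ((1 - q b) * (1 - c\<^sup>2 * q b))"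
  shows "\<mu> \<in> cmod ` kobayashi_competitors (ellipsoid k m) (axis k (of_real p)) v"
proof -
  define l where "l = (if v $ k = 0 then of_real \<mu> else - of_real \<mu> * sgn (v $ k))"
  have cl: "cmod l = \<mu>" using \<mu> by (simp add: l_def norm_mult norm_sgn)
  define V where "V = (1 - b\<^sup>2) / b + c * (1 - q b) / m"
  have "v $ k = - l * of_real (p * V)"
  proof (cases "v $ k = 0")
    case True
    then have "V = 0" using X \<mu> by (simp add: V_def[symmetric])
    then show ?thesis using True by simp
  next
    case False
    have "cmod (v $ k) = cmod (v $ k) / p * p" using p by simp
    also have "\<dots> = \<mu> * (p * V)" unfolding X V_def by simp
    finally have "cmod (v $ k) = \<mu> * (p * V)" .
    moreover have "v $ k = of_real (cmod (v $ k)) * sgn (v $ k)" using False by (simp add: sgn_eq)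
    ultimately have "v $ k = of_real (\<mu> * (p * V)) * sgn (v $ k)" by simp
    then show ?thesis using False by (simp add: l_def mult_ac)
  qed
  moreover have "l \<noteq> 0" using cl \<mu> by auto
  ultimately have "l \<in> kobayashi_competitors (ellipsoid k m) (axis k (of_real p)) v"
    using Y cl by (intro ellipsoid_disc[OF b c]) (auto simp: V_def)
  then show ?thesis using cl by (metis imageI)
qed

lemma competitor_estimate:
  fixes k :: "'n::finite" and v :: "complex ^ 'n"
  assumes l: "l \<in> kobayashi_competitors (ellipsoid k m) (axis k (of_real p)) v"
    and r: "0 < r" "r < 1"
  defines "X \<equiv> cmod (v $ k) / p" and "Y \<equiv> sqrt (\<Sum>i\<in>UNIV - {k}. (cmod (v $ i))\<^sup>2)" and "\<mu> \<equiv> cmod l / r"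
  assumes Y: "Y > 0"
  shows "\<mu> > 0" and "(\<exists>b. p < b \<and> b \<le> cusp \<and> envG2 b = (Y / \<mu>)\<^sup>2 \<and> X / \<mu> \<le> envV b)
    \<or> (1 - P < Y / \<mu> \<and> P * (m * (X / \<mu>))\<^sup>2 + (1 - P) * (Y / \<mu>)\<^sup>2 \<le> (1 - P)\<^sup>2)"
proof -
  obtain f where f: "holomorphic_disc f (ellipsoid k m)" "f 0 = axis k (of_real p)" "l *s disc_deriv f 0 = v"
    using l by (auto simp: kobayashi_competitors_def)
  have hol: "(\<lambda>\<zeta>. f \<zeta> $ i) holomorphic_on ball 0 1" for i
    using f(1) by (simp add: holomorphic_disc_def)
  have mem: "cmod (f \<zeta> $ k) powr (2 * m) + (\<Sum>i\<in>UNIV - {k}. (cmod (f \<zeta> $ i))\<^sup>2) < 1" if "\<zeta> \<in> ball 0 1" for \<zeta>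
    using f(1) that by (auto simp: holomorphic_disc_def ellipsoid_def image_subset_iff)
  have vi: "v $ i = l * deriv (\<lambda>\<zeta>. f \<zeta> $ i) 0" for i
    using arg_cong[OF f(3), of "\<lambda>v. v $ i"] by (simp add: disc_deriv_def)
  have "l \<noteq> 0" using Y vi by (auto simp: Y_def)
  then show \<mu>: "\<mu> > 0" using r by (simp add: \<mu>_def)
  have Y2: "Y\<^sup>2 = (\<Sum>i\<in>UNIV - {k}. (cmod (v $ i))\<^sup>2)" by (simp add: Y_def sum_nonneg)
  define F where "F = (\<lambda>i \<zeta>. f (of_real r * \<zeta>) $ i)"
  define g where "g = (\<lambda>\<zeta>. \<Sum>i\<in>UNIV - {k}. (cnj (v $ i) / of_real Y) * F i \<zeta>)"
  have rb: "of_real r * \<zeta> \<in> ball 0 1" if "\<zeta> \<in> ball (0::complex) (1 / r)" for \<zeta>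
    using that r by (simp add: norm_mult field_simps)
  have holF: "F i holomorphic_on ball 0 (1 / r)" for i
    unfolding F_def
    by (rule holomorphic_on_compose_gen[unfolded o_def, OF _ hol]) (use rb in \<open>auto intro!: holomorphic_intros\<close>)
  have holg: "g holomorphic_on ball 0 (1 / r)"
    unfolding g_def by (intro holomorphic_intros holF)
  have dF: "(F i has_field_derivative r * (v $ i / l)) (at 0)" for i
  proof -
    have "((\<lambda>\<zeta>. f \<zeta> $ i) has_field_derivative deriv (\<lambda>\<zeta>. f \<zeta> $ i) 0) (at (of_real r * 0))"
      using holomorphic_derivI[OF hol[of i], of 0] by simp
    then have "(F i has_field_derivative deriv (\<lambda>\<zeta>. f \<zeta> $ i) 0 * of_real r) (at 0)"
      unfolding F_def by (rule DERIV_chain2) (auto intro!: derivative_eq_intros)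
    then show ?thesis using vi[of i] \<open>l \<noteq> 0\<close> by (simp add: mult.commute)
  qed
  have "(g has_field_derivative (\<Sum>i\<in>UNIV - {k}. (cnj (v $ i) / of_real Y) * (r * (v $ i / l)))) (at 0)"
    unfolding g_def by (intro DERIV_sum DERIV_cmult dF)
  also have "(\<Sum>i\<in>UNIV - {k}. (cnj (v $ i) / of_real Y) * (r * (v $ i / l)))
      = (\<Sum>i\<in>UNIV - {k}. of_real ((cmod (v $ i))\<^sup>2) * (of_real r / (of_real Y * l)))"
    by (intro sum.cong refl) (simp only: complex_norm_square, simp)
  also have "\<dots> = of_real (Y\<^sup>2) * (of_real r / (of_real Y * l))"
    by (simp only: Y2 of_real_sum sum_distrib_right)
  finally have "deriv g 0 = of_real Y * of_real r / l"
    using Y by (simp add: DERIV_imp_deriv power2_eq_square)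
  then have G: "Y / \<mu> = cmod (deriv g 0)"
    using Y r by (simp add: norm_mult norm_divide \<mu>_def)
  have g_le: "(cmod (g \<zeta>))\<^sup>2 \<le> (\<Sum>i\<in>UNIV - {k}. (cmod (F i \<zeta>))\<^sup>2)" for \<zeta>
  proof -
    have "cmod (g \<zeta>) \<le> (\<Sum>i\<in>UNIV - {k}. \<bar>cmod (v $ i) / Y\<bar> * \<bar>cmod (F i \<zeta>)\<bar>)"
      unfolding g_def using Y by (intro sum_norm_le) (simp add: norm_mult norm_divide)
    also have "\<dots> \<le> L2_set (\<lambda>i. cmod (v $ i) / Y) (UNIV - {k}) * L2_set (\<lambda>i. cmod (F i \<zeta>)) (UNIV - {k})"
      by (rule L2_set_mult_ineq)
    also have "L2_set (\<lambda>i. cmod (v $ i) / Y) (UNIV - {k}) = 1"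
      using Y by (simp add: L2_set_def power_divide sum_divide_distrib[symmetric] Y2[symmetric])
    finally have "cmod (g \<zeta>) \<le> sqrt (\<Sum>i\<in>UNIV - {k}. (cmod (F i \<zeta>))\<^sup>2)" by (simp add: L2_set_def)
    then show ?thesis by (metis norm_ge_zero power_mono real_sqrt_pow2 sum_nonneg zero_le_power2)
  qed
  have le: "cmod (F k \<zeta>) powr (2 * m) + (cmod (g \<zeta>))\<^sup>2 \<le> 1" if "\<zeta> \<in> ball 0 (1 / r)" for \<zeta>
    using mem[OF rb[OF that]] g_le[of \<zeta>] unfolding F_def by linarith
  have F0: "F k 0 = of_real p" and g0: "g 0 = 0"
    using f(2) by (auto simp: F_def g_def axis_def)
  have dFk: "cmod (deriv (F k) 0) = p * (X / \<mu>)"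
    using DERIV_imp_deriv[OF dF[of k]] r p by (simp add: norm_mult norm_divide X_def \<mu>_def)
  have "1 / r > 1" using r by simp
  from disc_pair_estimate[OF holF[of k] holg this le F0 g0 p(1) m(1) G]
  obtain a W where a: "p \<le> a" "a \<le> 1" and W: "0 \<le> W"
    and V: "p * (X / \<mu>) \<le> p * ((1 - a\<^sup>2) / a + W / m)"
    and ball: "q a * W\<^sup>2 + (1 - q a) * (Y / \<mu>)\<^sup>2 \<le> (1 - q a)\<^sup>2" "(Y / \<mu>)\<^sup>2 \<le> 1 - q a"
    and log: "0 < Y / \<mu> \<Longrightarrow> Y / \<mu> \<le> 1 - q a \<Longrightarrow> W \<le> Y / \<mu> + ln ((1 - Y / \<mu>) / q a)"
    unfolding q_def[symmetric] dFk by blast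
  have G0: "0 < Y / \<mu>" using Y \<mu> by simp
  show "(\<exists>b. p < b \<and> b \<le> cusp \<and> envG2 b = (Y / \<mu>)\<^sup>2 \<and> X / \<mu> \<le> envV b)
    \<or> (1 - P < Y / \<mu> \<and> P * (m * (X / \<mu>))\<^sup>2 + (1 - P) * (Y / \<mu>)\<^sup>2 \<le> (1 - P)\<^sup>2)"
  proof (rule feasible_bound[OF a G0 W _ _ ball log[OF G0]])
    show "0 \<le> X / \<mu>" using p \<mu> by (simp add: X_def)
    show "X / \<mu> \<le> (1 - a\<^sup>2) / a + W / m" by (rule mult_left_le_imp_le[OF V p(1)])
  qed
qed

lemma competitor_schwarz_pick:
  fixes k :: "'n::finite" and v :: "complex ^ 'n"
  assumes l: "l \<in> kobayashi_competitors (ellipsoid k m) (axis k (of_real p)) v"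
  shows "cmod (v $ k) \<le> cmod l * (1 - p\<^sup>2)"
proof -
  obtain f where f: "holomorphic_disc f (ellipsoid k m)" "f 0 = axis k (of_real p)" "l *s disc_deriv f 0 = v"
    using l by (auto simp: kobayashi_competitors_def)
  have "cmod (f \<zeta> $ k) \<le> 1" if "\<zeta> \<in> ball 0 1" for \<zeta>
  proof (rule ccontr)
    assume "\<not> ?thesis"
    then have "cmod (f \<zeta> $ k) powr (2 * m) \<ge> 1" using m by (intro ge_one_powr_ge_zero) auto
    moreover have "cmod (f \<zeta> $ k) powr (2 * m) + (\<Sum>i\<in>UNIV - {k}. (cmod (f \<zeta> $ i))\<^sup>2) < 1"
      using f(1) that by (auto simp: holomorphic_disc_def ellipsoid_def image_subset_iff)
    ultimately show False using sum_nonneg[of "UNIV - {k}" "\<lambda>i. (cmod (f \<zeta> $ i))\<^sup>2"] by simp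
  qed
  then have "cmod (deriv (\<lambda>\<zeta>. f \<zeta> $ k) 0) \<le> 1 - p\<^sup>2"
    using schwarz_pick_0[of "\<lambda>\<zeta>. f \<zeta> $ k"] f p by (simp add: holomorphic_disc_def axis_def)
  moreover have "v $ k = l * deriv (\<lambda>\<zeta>. f \<zeta> $ k) 0"
    using arg_cong[OF f(3), of "\<lambda>v. v $ k"] by (simp add: disc_deriv_def)
  ultimately show ?thesis by (simp add: norm_mult mult_left_mono)
qed

end

locale ellipsoid_tangent = ellipsoid_point +
  fixes k :: "'n::finite" and v :: "complex ^ 'n"
  assumes v: "v \<noteq> 0"
begin

definition X :: real where "X = cmod (v $ k) / p"
definition Y :: real where "Y = sqrt (\<Sum>i\<in>UNIV - {k}. (cmod (v $ i))\<^sup>2)"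
abbreviation "w \<equiv> w_par k m p v"
abbreviation "Comp \<equiv> kobayashi_competitors (ellipsoid k m) (axis k (complex_of_real p)) v"

lemma Y2: "(\<Sum>i\<in>UNIV - {k}. (cmod (v $ i))\<^sup>2) = Y\<^sup>2"
  by (simp add: Y_def sum_nonneg)

lemma XY: "X \<ge> 0" "Y \<ge> 0" "X > 0 \<or> Y > 0"
proof -
  show "X \<ge> 0" "Y \<ge> 0" using p by (auto simp: X_def Y_def sum_nonneg)
  obtain i where i: "v $ i \<noteq> 0" using v by (auto simp: vec_eq_iff)
  show "X > 0 \<or> Y > 0"
  proof (cases "i = k")
    case True then show ?thesis using i p by (simp add: X_def)
  next
    case False
    then have "(\<Sum>i\<in>UNIV - {k}. (cmod (v $ i))\<^sup>2) > 0" using i by (intro sum_pos2[of _ i]) auto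
    then show ?thesis by (simp add: Y_def)
  qed
qed

lemma w_eq: "w = (if X = 0 then \<infinity> else ereal (Y\<^sup>2 / (m\<^sup>2 * X\<^sup>2)))"
  using p by (simp add: w_par_def Y2 X_def power_divide)

lemma w_le_iff: "w \<le> ereal c \<longleftrightarrow> X > 0 \<and> Y\<^sup>2 / (m\<^sup>2 * X\<^sup>2) \<le> c"
  using XY by (auto simp: w_eq)

lemma w_ge_iff: "w \<ge> ereal c \<longleftrightarrow> c * (m\<^sup>2 * X\<^sup>2) \<le> Y\<^sup>2" if "c > 0"
  using XY m that by (auto simp: w_eq pos_le_divide_eq)

lemma K2_eq: "K2 k m p v = ball_metric X Y"
proof -
  have "p powr (2 * m - 2) = P / p\<^sup>2" using p by (simp add: powr_diff P_def)
  then have "m\<^sup>2 * p powr (2 * m - 2) * (cmod (v $ k))\<^sup>2 / (1 - P)\<^sup>2 = P * (m * X)\<^sup>2 / (1 - P)\<^sup>2"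
    by (simp add: X_def power_divide power_mult_distrib)
  moreover have "(\<Sum>i\<in>UNIV - {k}. (cmod (v $ i))\<^sup>2 / (1 - P)) = (1 - P) * Y\<^sup>2 / (1 - P)\<^sup>2"
    using P_bounds by (simp add: sum_divide_distrib[symmetric] Y2 power2_eq_square[of "1 - P"])
  ultimately have "K2 k m p v = sqrt ((P * (m * X)\<^sup>2 + (1 - P) * Y\<^sup>2) / (1 - P)\<^sup>2)"
    unfolding K2_def P_def[symmetric] by (simp add: add_divide_distrib)
  then show ?thesis using P_bounds by (simp add: ball_metric_def real_sqrt_divide)
qed

lemma K2_pos: "ball_metric X Y > 0"
proof -
  have "P * (m * X)\<^sup>2 + (1 - P) * Y\<^sup>2 > 0"
    using XY P_bounds m by (auto intro: add_pos_nonneg add_nonneg_pos)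
  then show ?thesis using P_bounds by (simp add: ball_metric_def)
qed

definition a where "a = alpha_par m p (t_par m (real_of_ereal w))"

lemma a_props:
  assumes "w \<le> ereal (w_max m)"
  shows "\<exists>!x. alpha_sol m p (t_par m (real_of_ereal w)) x" "p \<le> a" "a \<le> cusp" "X > 0"
    "ratio a = Y\<^sup>2 / (m\<^sup>2 * X\<^sup>2)" "K1 k m p v = X / envV a" "envV a > 0"
proof -
  show X: "X > 0" using assms w_le_iff by simp
  have w: "real_of_ereal w = Y\<^sup>2 / (m\<^sup>2 * X\<^sup>2)" using X by (simp add: w_eq)
  have w': "0 \<le> real_of_ereal w" "real_of_ereal w \<le> w_max m" using assms w_le_iff w by auto
  note ap = alpha_par_props[OF w', folded a_def]
  show "\<exists>!x. alpha_sol m p (t_par m (real_of_ereal w)) x" by (rule ap)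
  show a: "p \<le> a" "a \<le> cusp" by (rule ap)+
  show "ratio a = Y\<^sup>2 / (m\<^sup>2 * X\<^sup>2)" using ap w by simp
  show "K1 k m p v = X / envV a"
    unfolding K1_def Let_def a_def[symmetric] ap(5) by (simp add: X_def)
  show "envV a > 0" using a cusp by (intro envV_pos) auto
qed

lemma K1_attained:
  assumes "w \<le> ereal (w_max m)"
  shows "K1 k m p v \<in> cmod ` Comp"
proof -
  note a = a_props[OF assms]
  have a1: "a \<le> 1" using a cusp by simp
  show ?thesis unfolding a(6)
  proof (rule ellipsoid_disc_real[where b = a and c = a])
    show "cmod (v $ k) / p = X / envV a * ((1 - a\<^sup>2) / a + a * (1 - q a) / m)"
      using a(7) by (simp add: X_def[symmetric] envV_def[symmetric])
    have "Y\<^sup>2 = (X / envV a)\<^sup>2 * envG2 a"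
      using a(4,5,7) m by (simp add: ratio_def field_simps)
    then show "(\<Sum>i\<in>UNIV - {k}. (cmod (v $ i))\<^sup>2) = (X / envV a)\<^sup>2 * ((1 - q a) * (1 - a\<^sup>2 * q a))"
      by (simp add: Y2 envG2_def)
  qed (use a a1 p in auto)
qed

lemma K2_attained:
  assumes "w \<ge> 1"
  shows "K2 k m p v \<in> cmod ` Comp"
proof -
  define \<mu> where "\<mu> = ball_metric X Y"
  have \<mu>: "\<mu> > 0" using K2_pos by (simp add: \<mu>_def)
  have XY1: "m\<^sup>2 * X\<^sup>2 \<le> Y\<^sup>2" using assms w_ge_iff[of 1] by (simp add: one_ereal_def)
  have P: "0 < P" "0 < 1 - P" using P_bounds by auto
  have \<mu>2: "\<mu>\<^sup>2 * (1 - P)\<^sup>2 = P * (m\<^sup>2 * X\<^sup>2) + (1 - P) * Y\<^sup>2"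
    using P by (simp add: \<mu>_def ball_metric_def power_divide power_mult_distrib)
  define c where "c = m * X / (\<mu> * (1 - P))"
  have cm: "c * (\<mu> * (1 - P)) = m * X" using \<mu> P by (simp add: c_def)
  have c0: "c \<ge> 0" using m XY \<mu> P by (simp add: c_def)
  have c1: "c \<le> 1"
  proof -
    have "(1 - P) * (m\<^sup>2 * X\<^sup>2) \<le> (1 - P) * Y\<^sup>2" using XY1 P by (intro mult_left_mono) auto
    then have "(m * X)\<^sup>2 \<le> (\<mu> * (1 - P))\<^sup>2" using \<mu>2 unfolding power_mult_distrib left_diff_distrib by linarith
    then have "m * X \<le> \<mu> * (1 - P)" by (rule power2_le_imp_le) (use \<mu> P in auto)
    then show ?thesis using \<mu> P by (simp add: c_def)
  qed
  show ?thesis unfolding K2_eq \<mu>_def[symmetric]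
  proof (rule ellipsoid_disc_real[where b = 1 and c = c])
    show "cmod (v $ k) / p = \<mu> * ((1 - 1\<^sup>2) / 1 + c * (1 - q 1) / m)"
      using cm m by (simp add: X_def[symmetric] q_1 field_simps)
    have "(1 - P) * Y\<^sup>2 = \<mu>\<^sup>2 * (1 - P)\<^sup>2 - P * (c * (\<mu> * (1 - P)))\<^sup>2"
      unfolding cm using \<mu>2 by (simp add: power_mult_distrib)
    also have "\<dots> = (1 - P) * (\<mu>\<^sup>2 * ((1 - P) * (1 - c\<^sup>2 * P)))"
      by (simp add: power2_eq_square algebra_simps)
    finally have "Y\<^sup>2 = \<mu>\<^sup>2 * ((1 - P) * (1 - c\<^sup>2 * P))" using P by simp
    then show "(\<Sum>i\<in>UNIV - {k}. (cmod (v $ i))\<^sup>2) = \<mu>\<^sup>2 * ((1 - q 1) * (1 - c\<^sup>2 * q 1))"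
      by (simp add: Y2 q_1)
  qed (use p c0 c1 \<mu> in auto)
qed

lemma lower:
  assumes l: "l \<in> Comp" and r: "0 < r" "r < 1"
  shows "w \<le> 1 \<Longrightarrow> K1 k m p v \<le> cmod l / r"
    and "w \<ge> ereal (w_max m) \<Longrightarrow> K2 k m p v \<le> cmod l / r"
    and "w \<le> ereal (w_max m) \<Longrightarrow> min (K1 k m p v) (K2 k m p v) \<le> cmod l / r"
proof -
  define \<mu> where "\<mu> = cmod l / r"
  have *: "(w \<le> ereal (w_max m) \<longrightarrow> K1 k m p v \<le> \<mu>) \<and> (w \<ge> ereal (w_max m) \<longrightarrow> K2 k m p v \<le> \<mu>)
     \<or> (K2 k m p v \<le> \<mu> \<and> \<not> w \<le> 1)"
  proof (cases "Y > 0")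
    case True
    note est = competitor_estimate[OF l r, folded X_def Y_def \<mu>_def, OF True]
    from est(2) show ?thesis
    proof (elim disjE exE conjE)
      fix b assume b: "p < b" "b \<le> cusp" "envG2 b = (Y / \<mu>)\<^sup>2" "X / \<mu> \<le> envV b"
      have "K1 k m p v \<le> \<mu>" if "w \<le> ereal (w_max m)"
        using a_props[OF that] lower_bound_envelope[OF _ _ _ True _ b est(1)] by simp
      moreover have "K2 k m p v \<le> \<mu>" if "w \<ge> ereal (w_max m)"
        using lower_bound_ball_envelope[OF XY(1) True _ b(1-3) est(1)] that w_ge_iff[of "w_max m"] w_max_gt_1
        by (simp add: K2_eq)
      ultimately show ?thesis by blast
    next
      assume b: "1 - P < Y / \<mu>" "P * (m * (X / \<mu>))\<^sup>2 + (1 - P) * (Y / \<mu>)\<^sup>2 \<le> (1 - P)\<^sup>2"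
      have "\<not> w \<le> ereal 1"
        using lower_bound_ball(2)[OF b est(1)] m unfolding w_le_iff by (auto simp: divide_le_eq)
      then show ?thesis using lower_bound_ball(1)[OF b est(1)] by (simp add: K2_eq one_ereal_def)
    qed
  next
    case False
    then have Y: "Y = 0" and X: "X > 0" using XY by auto
    then have w0: "w = 0" by (simp add: w_eq zero_ereal_def)
    then have wle: "w \<le> ereal (w_max m)" using w_max_gt_1 by simp
    note a = a_props[OF wle]
    have "envG2 a = 0" using a(5,7) m Y by (simp add: ratio_def)
    then have ap: "a = p" using envG2_pos[of a] a cusp by (cases "a = p") auto
    have "K1 k m p v = cmod (v $ k) / (1 - p\<^sup>2)"
      unfolding a(6) ap using p by (simp add: X_def envV_def q_p)
    also have "\<dots> \<le> cmod l"
      using competitor_schwarz_pick[OF l] p by (simp add: divide_le_eq power_less_one_iff)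
    also have "\<dots> \<le> \<mu>" using r by (simp add: \<mu>_def pos_le_divide_eq mult_left_le)
    finally show ?thesis using w0 w_max_gt_1 by simp
  qed
  have "w \<le> 1 \<Longrightarrow> w \<le> ereal (w_max m)" using w_max_gt_1 by (metis ereal_less_eq(3) less_imp_le one_ereal_def order_trans)
  then show "w \<le> 1 \<Longrightarrow> K1 k m p v \<le> cmod l / r" using * by (auto simp: \<mu>_def)
  have "w \<ge> ereal (w_max m) \<Longrightarrow> K2 k m p v \<le> \<mu>" using * by auto
  then show "w \<ge> ereal (w_max m) \<Longrightarrow> K2 k m p v \<le> cmod l / r" by (simp add: \<mu>_def)
  show "w \<le> ereal (w_max m) \<Longrightarrow> min (K1 k m p v) (K2 k m p v) \<le> cmod l / r"
    using * by (auto simp: \<mu>_def min_le_iff_disj)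
qed

lemma kobayashi_eqI:
  assumes "c \<in> cmod ` Comp" and "\<And>l r. l \<in> Comp \<Longrightarrow> 0 < r \<Longrightarrow> r < 1 \<Longrightarrow> c \<le> cmod l / r"
  shows "kobayashi (ellipsoid k m) (axis k (complex_of_real p)) v = c"
  unfolding kobayashi_def
proof (rule cInf_eq_minimum[OF assms(1)])
  fix x assume "x \<in> cmod ` Comp"
  then obtain l where l: "l \<in> Comp" "x = cmod l" by blast
  have "r * c \<le> x" if "0 < r" "r < 1" for r
    using assms(2)[OF l(1) that] that l by (simp add: field_simps)
  then show "c \<le> x" by (rule field_le_mult_one_interval)
qed

lemma kobayashi_formula:
  "kobayashi (ellipsoid k m) (axis k (complex_of_real p)) v =
      (if w \<le> 1 then K1 k m p v
       else if w \<ge> ereal (w_max m) then K2 k m p v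
       else min (K1 k m p v) (K2 k m p v))"
proof -
  consider "w \<le> 1" | "\<not> w \<le> 1" "w \<ge> ereal (w_max m)" | "\<not> w \<le> 1" "\<not> w \<ge> ereal (w_max m)" by blast
  then show ?thesis
  proof cases
    case 1
    then have "w \<le> ereal (w_max m)" using w_max_gt_1 by (metis ereal_less_eq(3) less_imp_le one_ereal_def order_trans)
    then show ?thesis using 1 K1_attained lower(1) by (simp add: kobayashi_eqI)
  next
    case 2
    then have "w \<ge> 1" by simp
    then show ?thesis using 2 K2_attained lower(2) by (simp add: kobayashi_eqI)
  next
    case 3
    then have w: "w \<ge> 1" "w \<le> ereal (w_max m)" by auto
    have "min (K1 k m p v) (K2 k m p v) \<in> cmod ` Comp"
      using K1_attained[OF w(2)] K2_attained[OF w(1)] by (auto simp: min_def)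
    then show ?thesis using 3 lower(3)[OF _ _ _ w(2)] by (simp add: kobayashi_eqI)
  qed
qed

lemma K1_K2_compare:
  assumes x: "p < x" "x < cusp" "ball_norm2 x = 1" and w: "w \<le> ereal (w_max m)"
  shows "w \<le> ereal (ratio x) \<Longrightarrow> K1 k m p v \<le> K2 k m p v"
    and "w \<ge> ereal (ratio x) \<Longrightarrow> K2 k m p v \<le> K1 k m p v"
proof -
  note a = a_props[OF w]
  have wa: "w = ereal (ratio a)" using a(4,5) by (simp add: w_eq)
  have K: "K2 k m p v = K1 k m p v * sqrt (ball_norm2 a)"
    using ball_metric_envelope[OF a(2-4) XY(2) a(5)] a(6) by (simp add: K2_eq)
  have K1: "K1 k m p v > 0" using a(4,6,7) by simp
  show "K1 k m p v \<le> K2 k m p v" if "w \<le> ereal (ratio x)"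
  proof -
    have "a \<le> x" using that ratio_less[of x a] a x wa by (cases "a \<le> x") auto
    then have "ball_norm2 x \<le> ball_norm2 a"
      using ball_norm2_decreasing[of a x] a p x by (cases "a = x") auto
    then show ?thesis using x K K1 by simp
  qed
  show "K2 k m p v \<le> K1 k m p v" if "w \<ge> ereal (ratio x)"
  proof -
    have "x \<le> a" using that ratio_less[of a x] a x wa by (cases "x \<le> a") auto
    then have "ball_norm2 a \<le> ball_norm2 x"
      using ball_norm2_decreasing[of x a] a p x by (cases "a = x") auto
    then show ?thesis using x K K1 by simp
  qed
qed

lemma kobayashi_switch:
  assumes x: "p < x" "x < cusp" "ball_norm2 x = 1" "1 < ratio x"
  shows "w \<le> ereal (ratio x) \<Longrightarrow> kobayashi (ellipsoid k m) (axis k (complex_of_real p)) v = K1 k m p v"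
    and "w \<ge> ereal (ratio x) \<Longrightarrow> kobayashi (ellipsoid k m) (axis k (complex_of_real p)) v = K2 k m p v"
proof -
  have lt: "ratio x < w_max m" using ratio_less[of x cusp] x ratio_cusp by simp
  show "kobayashi (ellipsoid k m) (axis k (complex_of_real p)) v = K1 k m p v" if w: "w \<le> ereal (ratio x)"
  proof -
    have "w < ereal (w_max m)" using w lt by (metis ereal_less_eq(3) le_less_trans less_ereal.simps(1))
    then show ?thesis
      unfolding kobayashi_formula using K1_K2_compare(1)[OF x(1-3) _ w] by (auto simp: min_absorb1)
  qed
  show "kobayashi (ellipsoid k m) (axis k (complex_of_real p)) v = K2 k m p v" if w: "w \<ge> ereal (ratio x)"
  proof -
    have "\<not> w \<le> 1" using w x(4) by (metis ereal_less_eq(3) linorder_not_le one_ereal_def order_trans)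
    then show ?thesis
      unfolding kobayashi_formula using K1_K2_compare(2)[OF x(1-3) _ w] by (auto simp: min_absorb2)
  qed
qed

end

theorem theorem2p1:
  fixes k :: "'n::finite" and m p :: real
  assumes n: "CARD('n) \<ge> 2"
    and m: "0 < m" "m < 1 / 2"
    and p: "0 < p" "p < 1"
  shows "(\<forall>v :: complex ^ 'n. v \<noteq> 0 \<longrightarrow>
            (w_par k m p v \<le> ereal (w_max m) \<longrightarrow>
               (\<exists>!a. alpha_sol m p (t_par m (real_of_ereal (w_par k m p v))) a)) \<and>
            kobayashi (ellipsoid k m) (axis k (complex_of_real p)) v =
              (if w_par k m p v \<le> 1 then K1 k m p v
               else if w_par k m p v \<ge> ereal (w_max m) then K2 k m p v
               else min (K1 k m p v) (K2 k m p v))) \<and>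
         (\<exists>w0 t0 x0 :: real.
            1 < w0 \<and> w0 < w_max m \<and>
            (\<forall>v :: complex ^ 'n. v \<noteq> 0 \<longrightarrow>
               (w_par k m p v \<le> ereal w0 \<longrightarrow>
                  kobayashi (ellipsoid k m) (axis k (complex_of_real p)) v = K1 k m p v) \<and>
               (w_par k m p v \<ge> ereal w0 \<longrightarrow>
                  kobayashi (ellipsoid k m) (axis k (complex_of_real p)) v = K2 k m p v)) \<and>
            w0 = t0 / (m + (1 - m) * t0)\<^sup>2 \<and>
            t0 = (x0 powr (2 * m) - p powr (2 * m)) / (x0 powr (2 * m - 2) - p powr (2 * m)) \<and>
            x0_sol m p x0 \<and> (\<forall>x. x0_sol m p x \<longrightarrow> x = x0))"
proof -
  interpret ellipsoid_point m p using m p by unfold_locales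
  obtain x where x: "p < x" "x < cusp" "ball_norm2 x = 1" "1 < ratio x"
    using switch_exists by blast
  have x1: "p \<le> x" "x < 1" "x > 0" using x cusp p by auto
  have tangent: "ellipsoid_tangent m p v" if "v \<noteq> 0" for v :: "complex ^ 'n"
    using that by unfold_locales
  have t0: "tpar x = (x powr (2 * m) - p powr (2 * m)) / (x powr (2 * m - 2) - p powr (2 * m))"
  proof -
    define Z where "Z = x powr (2 * m)"
    have Z: "Z > 0" using x1 by (simp add: Z_def)
    have "x powr (2 * m - 2) = Z / x\<^sup>2" using x1 by (simp add: Z_def powr_diff)
    moreover have "tpar x = (x\<^sup>2 * (Z - P) / Z) / ((Z - x\<^sup>2 * P) / Z)"
    proof -
      have "q x = P / Z" using q_eq[OF x1(3)] by (simp only: Z_def)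
      moreover have "1 - P / Z = (Z - P) / Z" "1 - x\<^sup>2 * (P / Z) = (Z - x\<^sup>2 * P) / Z"
        using Z by (auto simp: diff_divide_distrib)
      ultimately show ?thesis by (simp only: tpar_def times_divide_eq_right)
    qed
    moreover have "Z / x\<^sup>2 - P = (Z - x\<^sup>2 * P) / x\<^sup>2" using x1 by (simp add: field_simps)
    ultimately show ?thesis using Z x1 by (simp add: Z_def[symmetric] P_def[symmetric])
  qed
  have uniq: "\<forall>y. x0_sol m p y \<longrightarrow> y = x"
  proof (intro allI impI)
    fix y assume y: "x0_sol m p y"
    have y': "0 < y" "y < 1" "ball_norm2 y = 1" using y by (auto simp: x0_sol_iff)
    have "y < cusp" using ball_norm2_less_1[of y] y' by (cases "y < cusp") auto
    then show "y = x"
      using ball_norm2_decreasing[of x y] ball_norm2_decreasing[of y x] x x1 y'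
      by (cases x y rule: linorder_cases) auto
  qed
  have sol: "x0_sol m p x" using x x1 by (simp add: x0_sol_iff)
  have lt: "ratio x < w_max m" using ratio_less[of x cusp] x ratio_cusp by simp
  have switch: "\<forall>v :: complex ^ 'n. v \<noteq> 0 \<longrightarrow>
               (w_par k m p v \<le> ereal (ratio x) \<longrightarrow>
                  kobayashi (ellipsoid k m) (axis k (complex_of_real p)) v = K1 k m p v) \<and>
               (w_par k m p v \<ge> ereal (ratio x) \<longrightarrow>
                  kobayashi (ellipsoid k m) (axis k (complex_of_real p)) v = K2 k m p v)"
    using ellipsoid_tangent.kobayashi_switch[OF tangent x] by blast
  have formula: "\<forall>v :: complex ^ 'n. v \<noteq> 0 \<longrightarrow>
            (w_par k m p v \<le> ereal (w_max m) \<longrightarrow>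
               (\<exists>!a. alpha_sol m p (t_par m (real_of_ereal (w_par k m p v))) a)) \<and>
            kobayashi (ellipsoid k m) (axis k (complex_of_real p)) v =
              (if w_par k m p v \<le> 1 then K1 k m p v
               else if w_par k m p v \<ge> ereal (w_max m) then K2 k m p v
               else min (K1 k m p v) (K2 k m p v))"
    using ellipsoid_tangent.a_props(1)[OF tangent] ellipsoid_tangent.kobayashi_formula[OF tangent]
    by blast
  show ?thesis
    by (intro conjI exI[of _ "ratio x"] exI[of _ "tpar x"] exI[of _ x])
      (fact formula x(4) lt switch tpar_env(3)[OF x1(1,2)] t0 sol uniq)+
qed

end
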